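(* Let $G$ be a finite simple undirected graph that contains no induced subgraph isomorphic to the Chair and no induced subgraph isomorphic to the Kite. Then $\chi(G) \leq \left\lceil \frac{\Delta(G) + \omega(G) + 1}{2} \right\rceil$.
   Context: $\chi(G)$, $\Delta(G)$, $\omega(G)$ denote the chromatic number, maximum degree and clique number of $G$. The Chair (also called fork) is the 5-vertex graph obtained from the star $K_{1,3}$ by subdividing one edge once (vertices $a,b,c,d,e$ with edges $ab, bc, bd, de$). The Kite is the complement of the Chair: the 5-vertex graph obtained from the diamond $K_4 - e$ by adding a new vertex adjacent to exactly one of the two degree-2 vertices of the diamond. "Contains no induced subgraph isomorphic to $F$" means no subset of vertices of $G$ induces a graph isomorphic to $F$. *)

theory Defs
  imports Complex_Main "Graph_Theory.Graph_Theory"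
begin

text \<open>
  Finite simple undirected graphs are represented by \<^locale>\<open>pair_graph\<close>: a finite vertex set with
  a symmetric irreflexive set of arcs, each undirected edge \<open>uv\<close> being the two arcs
  \<open>(u, v)\<close> and \<open>(v, u)\<close>.
\<close>

definition undirected :: "'a set \<Rightarrow> 'a rel \<Rightarrow> 'a pair_pre_digraph" where
  "undirected V E = \<lparr> pverts = V, parcs = E \<union> E\<inverse> \<rparr>"

definition graph_complement :: "'a pair_pre_digraph \<Rightarrow> 'a pair_pre_digraph" where
  "graph_complement G = \<lparr> pverts = pverts G,
     parcs = {(u, v). u \<in> pverts G \<and> v \<in> pverts G \<and> u \<noteq> v \<and> (u, v) \<notin> parcs G} \<rparr>"

text \<open>The vertices \<open>a, b, c, d, e\<close> are \<open>0, 1, 2, 3, 4\<close>; the edges are \<open>ab, bc, bd, de\<close>.\<close>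

definition Chair :: "nat pair_pre_digraph" where
  "Chair = undirected {0, 1, 2, 3, 4} {(0, 1), (1, 2), (1, 3), (3, 4)}"

definition Kite :: "nat pair_pre_digraph" where
  "Kite = graph_complement Chair"

text \<open>
  The explicit form of the Kite: a diamond on \<open>0, 2, 3, 4\<close> whose vertices of degree 2
  are \<open>3\<close> and \<open>4\<close>, and the further vertex \<open>1\<close> adjacent to \<open>4\<close> only.
\<close>

lemma Kite_eq:
  "Kite = undirected {0, 1, 2, 3, 4} {(0, 2), (0, 3), (2, 3), (0, 4), (2, 4), (1, 4)}"
  (is "_ = undirected ?V ?E")
proof -
  have C: "pverts Chair = ?V" by (simp add: Chair_def undirected_def)
  have aux: "{(u, v). u \<in> V \<and> v \<in> V \<and> u \<noteq> v \<and> (u, v) \<notin> A} = E \<union> E\<inverse>"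
    if "\<forall>u \<in> V. \<forall>v \<in> V. (u, v) \<in> E \<union> E\<inverse> \<longleftrightarrow> u \<noteq> v \<and> (u, v) \<notin> A" and "E \<subseteq> V \<times> V"
    for V :: "nat set" and A E
    using that by blast
  have "{(u, v). u \<in> ?V \<and> v \<in> ?V \<and> u \<noteq> v \<and> (u, v) \<notin> parcs Chair} = ?E \<union> ?E\<inverse>"
    by (rule aux) (simp_all add: Chair_def undirected_def)
  then show ?thesis
    unfolding Kite_def graph_complement_def undirected_def C by simp
qed

lemma pair_graph_undirected:
  assumes "finite V" "E \<subseteq> V \<times> V" "\<And>v. (v, v) \<notin> E"
  shows "pair_graph (undirected V E)"
proof -
  have "finite E"
    using assms(1,2) finite_subset by blast
  then show ?thesis
    using assms by unfold_locales
      (auto simp: undirected_def symmetric_def intro!: symI)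
qed

lemma pair_graph_Chair: "pair_graph Chair"
  unfolding Chair_def by (rule pair_graph_undirected) auto

lemma pair_graph_Kite: "pair_graph Kite"
  unfolding Kite_eq by (rule pair_graph_undirected) auto

definition contains_induced :: "'a pair_pre_digraph \<Rightarrow> 'b pair_pre_digraph \<Rightarrow> bool" where
  "contains_induced G F \<longleftrightarrow>
     (\<exists>S \<subseteq> pverts G. digraph_iso (with_proj G \<restriction> S) (with_proj F))"

definition proper_colouring :: "'a pair_pre_digraph \<Rightarrow> nat \<Rightarrow> ('a \<Rightarrow> nat) \<Rightarrow> bool" where
  "proper_colouring G k f \<longleftrightarrow>
     f ` pverts G \<subseteq> {..<k} \<and> (\<forall>(u, v) \<in> parcs G. f u \<noteq> f v)"

definition chromatic_number :: "'a pair_pre_digraph \<Rightarrow> nat" where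
  "chromatic_number G = (LEAST k. \<exists>f. proper_colouring G k f)"

text \<open>
  By symmetry the out-degree is the number of neighbours. The maximum degree of the graph
  without vertices is taken to be 0.
\<close>

definition max_degree :: "'a pair_pre_digraph \<Rightarrow> nat" where
  "max_degree G = Max (insert 0 (out_degree (with_proj G) ` pverts G))"

definition is_clique :: "'a pair_pre_digraph \<Rightarrow> 'a set \<Rightarrow> bool" where
  "is_clique G S \<longleftrightarrow> S \<subseteq> pverts G \<and> (\<forall>u \<in> S. \<forall>v \<in> S. u \<noteq> v \<longrightarrow> (u, v) \<in> parcs G)"

definition clique_number :: "'a pair_pre_digraph \<Rightarrow> nat" where
  "clique_number G = Max (card ` {S. is_clique G S})"

text \<open>Containment as an induced subgraph in terms of an embedding of the vertices.\<close>

lemma contains_induced_iff: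
  assumes "pair_wf_digraph G" and "pair_wf_digraph F"
  shows "contains_induced G F \<longleftrightarrow>
    (\<exists>h. inj_on h (pverts F) \<and> h ` pverts F \<subseteq> pverts G \<and>
      (\<forall>u \<in> pverts F. \<forall>v \<in> pverts F. (h u, h v) \<in> parcs G \<longleftrightarrow> (u, v) \<in> parcs F))"
    (is "_ \<longleftrightarrow> (\<exists>h. ?emb h)")
proof
  interpret G: pair_wf_digraph G by fact
  interpret F: pair_wf_digraph F by fact
  {
    assume "contains_induced G F"
    then obtain S f where S: "S \<subseteq> pverts G"
      and iso: "pre_digraph.digraph_isomorphism (with_proj G \<restriction> S) f"
      and F: "with_proj F = app_iso f (with_proj G \<restriction> S)"
      unfolding contains_induced_def digraph_iso_def by blast
    define g where "g = iso_verts f"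
    have inj: "inj_on g S"
      using iso by (simp add: pre_digraph.digraph_isomorphism_def g_def)
    have "verts (with_proj F) = g ` S" and "iso_tail f = fst" and "iso_head f = snd"
      and "arcs (with_proj F) = iso_arcs f ` {e \<in> parcs G. fst e \<in> S \<and> snd e \<in> S}"
      using arg_cong[OF F, of verts] arg_cong[OF F, of tail] arg_cong[OF F, of head]
        arg_cong[OF F, of arcs] by (simp_all add: g_def)
    moreover from this(2,3) have "iso_arcs f e = (g (fst e), g (snd e))"
      if "e \<in> parcs G" "fst e \<in> S" "snd e \<in> S" for e
      using iso that
      by (cases e) (auto simp: pre_digraph.digraph_isomorphism_def g_def prod_eq_iff)
    ultimately have V: "pverts F = g ` S"
      and A: "parcs F = (\<lambda>e. (g (fst e), g (snd e))) ` {e \<in> parcs G. fst e \<in> S \<and> snd e \<in> S}"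
      by (auto cong: image_cong_simp)
    have A': "(g x, g y) \<in> parcs F \<longleftrightarrow> (x, y) \<in> parcs G" if "x \<in> S" "y \<in> S" for x y
      unfolding A using that inj by (force simp: inj_on_eq_iff)
    have "?emb (the_inv_into S g)"
      unfolding V using inj S A'
      by (auto simp: the_inv_into_f_f inj_on_def[of "the_inv_into S g"])
    then show "\<exists>h. ?emb h" by blast
  next
    assume "\<exists>h. ?emb h"
    then obtain h where h: "?emb h" by blast
    define g where "g = the_inv_into (pverts F) h"
    define S where "S = h ` pverts F"
    define f where "f = \<lparr> iso_verts = g, iso_arcs = (\<lambda>e. (g (fst e), g (snd e))),
      iso_head = snd, iso_tail = fst \<rparr>"
    have g: "g (h u) = u" if "u \<in> pverts F" for u
      using h that by (simp add: g_def the_inv_into_f_f)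
    have S: "S \<subseteq> pverts G"
      using h by (simp add: S_def)
    have inj: "inj_on g S"
      by (auto simp: S_def inj_on_def g)
    have "wf_digraph (with_proj G \<restriction> S)"
      using S by (intro G.wellformed_induce_subgraph)
    then have iso: "pre_digraph.digraph_isomorphism (with_proj G \<restriction> S) f"
      using inj by (auto simp: pre_digraph.digraph_isomorphism_def f_def inj_on_def)
    have "pverts F = g ` S"
      by (force simp: S_def g)
    moreover have "parcs F = (\<lambda>e. (g (fst e), g (snd e))) `
        {e \<in> parcs G. fst e \<in> S \<and> snd e \<in> S}" (is "_ = ?R")
    proof (intro set_eqI iffI)
      fix e assume "e \<in> parcs F"
      moreover obtain u v where "e = (u, v)" by fastforce
      ultimately have "u \<in> pverts F" "v \<in> pverts F" "(h u, h v) \<in> parcs G"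
        using F.in_arcsD1 F.in_arcsD2 h by blast+
      then show "e \<in> ?R"
        using \<open>e = (u, v)\<close> by (intro image_eqI[of _ _ "(h u, h v)"]) (auto simp: g S_def)
    next
      fix e assume "e \<in> ?R"
      then show "e \<in> parcs F"
        using h by (auto simp: S_def g)
    qed
    ultimately have "with_proj F = app_iso f (with_proj G \<restriction> S)"
      by (simp add: with_proj_def app_iso_def f_def)
    then show "contains_induced G F"
      using S iso unfolding contains_induced_def digraph_iso_def by blast
  }
qed

end

theory Submission
  imports Defs
begin

text \<open>
  Let \<open>G\<close> be a counterexample with as few vertices as possible, so that \<open>G\<close> is vertex-critical and
  not a join of two graphs. In a colouring of \<open>G - u\<close> with one colour too few, counting shows that
  the neighbours of \<open>u\<close> whose colour occurs only once at \<open>u\<close> do not form a clique; the Kempe chain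
  between two nonadjacent ones makes an odd hole through \<open>u\<close>. Excluding the chair and the kite leaves
  few ways to attach a vertex to an odd hole, and two cases arise.

  If some 5-hole has a vertex adjacent to a vertex of the hole and to the edge opposite to it, then
  \<open>G\<close> looks locally like the complement of a line graph: some vertex has bipartite
  non-neighbourhood and three pairwise nonadjacent neighbours, which makes its degree too large by
  the inequality \<open>2 \<chi> \<le> n + \<omega>\<close>.

  Otherwise every neighbourhood is the disjoint union of two cliques with no edges between them, so
  \<open>G\<close> is the line graph of a triangle-free graph, and the first step of Vizing's fan argument gives
  the bound.
\<close>

section \<open>Colourings\<close>

text \<open>A vertex complete to an odd hole creates no chair or kite with it, and neither does an
  anticomplete one. This is the obstacle: only minimality removes such vertices. Anticomplete
  vertices whose outside neighbours are all complete to the hole lie behind a cutset, across which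
  colourings of the two sides can be matched. With such pieces excluded, every vertex complete to
  the hole is adjacent to every vertex that is not, so a complete vertex would turn the graph into a
  join. Joins are harmless because the inequality 2t \<le> |D| + \<omega>(D) for colouring one side
  \<open>D\<close> with t colours fits the bound exactly: on the other side the degree drops by |D|
  and the clique number by \<omega>(D). In the line graph case the count is as follows. Each colour
  is missing at no more than one of x, y, y', so 2m \<le> (|X| + |Y|) + (|Y'| + 1). The first
  bracket is the degree of \<open>u\<close>, the second is the size of a clique, and the sum
  \<Delta> + w contradicts the bound.\<close>

locale sgraph =
  fixes E :: "'a \<Rightarrow> 'a \<Rightarrow> bool"
  assumes E_sym: "E x y \<Longrightarrow> E y x"
    and E_irrefl [simp]: "\<not> E x x"
begin

lemma E_commute: "E x y \<longleftrightarrow> E y x"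
  using E_sym by blast

definition colours :: "'a set \<Rightarrow> nat \<Rightarrow> ('a \<Rightarrow> nat) \<Rightarrow> bool" where
  "colours S m f \<longleftrightarrow> (\<forall>v\<in>S. f v < m) \<and> (\<forall>u\<in>S. \<forall>v\<in>S. E u v \<longrightarrow> f u \<noteq> f v)"

definition colourable :: "'a set \<Rightarrow> nat \<Rightarrow> bool" where
  "colourable S m \<longleftrightarrow> (\<exists>f. colours S m f)"

definition clique :: "'a set \<Rightarrow> bool" where
  "clique S \<longleftrightarrow> (\<forall>u\<in>S. \<forall>v\<in>S. u \<noteq> v \<longrightarrow> E u v)"

lemma colours_less: "colours S m f \<Longrightarrow> v \<in> S \<Longrightarrow> f v < m"
  and colours_neq: "colours S m f \<Longrightarrow> u \<in> S \<Longrightarrow> v \<in> S \<Longrightarrow> E u v \<Longrightarrow> f u \<noteq> f v"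
  by (auto simp: colours_def)

lemma colours_subset: "colours S m f \<Longrightarrow> T \<subseteq> S \<Longrightarrow> colours T m f"
  unfolding colours_def by blast

lemma colourable_Un:
  assumes "colourable S m" "colourable T k"
  shows "colourable (S \<union> T) (m + k)"
proof -
  from assms obtain f g where f: "colours S m f" and g: "colours T k g"
    by (auto simp: colourable_def)
  have "colours (S \<union> T) (m + k) (\<lambda>v. if v \<in> S then f v else m + g v)"
    unfolding colours_def
  proof (intro conjI ballI impI)
    fix v assume "v \<in> S \<union> T"
    then show "(if v \<in> S then f v else m + g v) < m + k"
      using colours_less[OF f, of v] colours_less[OF g, of v] by auto
  next
    fix u v assume "u \<in> S \<union> T" "v \<in> S \<union> T" "E u v"
    then show "(if u \<in> S then f u else m + g u) \<noteq> (if v \<in> S then f v else m + g v)"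
      using colours_less[OF f, of u] colours_less[OF f, of v] colours_neq[OF f, of u v]
        colours_neq[OF g, of u v] by auto
  qed
  then show ?thesis by (auto simp: colourable_def)
qed

lemma colourable_stable:
  assumes "\<And>u v. u \<in> S \<Longrightarrow> v \<in> S \<Longrightarrow> \<not> E u v"
  shows "colourable S (Suc 0)"
  unfolding colourable_def colours_def using assms by (intro exI[of _ "\<lambda>_. 0"]) auto

lemma colourable_subset: "colourable S m \<Longrightarrow> T \<subseteq> S \<Longrightarrow> colourable T m"
  unfolding colourable_def using colours_subset by blast

lemma colourable_mono: "colourable S m \<Longrightarrow> m \<le> k \<Longrightarrow> colourable S k"
  unfolding colourable_def colours_def using order_less_le_trans by blast

lemma inj_on_colours_clique:
  assumes "clique S" "colours S m f"
  shows "inj_on f S"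
  using assms unfolding clique_def colours_def inj_on_def by blast

text \<open>Colour classes of size two on a maximal matching of the complement, whose unmatched vertices
  form a clique.\<close>

lemma colourable_half:
  assumes "finite S" "\<And>C. C \<subseteq> S \<Longrightarrow> clique C \<Longrightarrow> card C \<le> w"
  shows "\<exists>t. colourable S t \<and> 2 * t \<le> card S + w"
  using assms
proof (induction S rule: finite_psubset_induct)
  case (psubset S)
  show ?case
  proof (cases "clique S")
    case True
    obtain f where "bij_betw f S {..<card S}"
      using psubset.hyps finite_same_card_bij[of S "{..<card S}"] by auto
    then have "colours S (card S) f"
      by (auto simp: colours_def bij_betw_def inj_on_def)
    then show ?thesis
      using True psubset.prems by (intro exI[of _ "card S"]) (auto simp: colourable_def)
  next
    case False
    then obtain x y where xy: "x \<in> S" "y \<in> S" "x \<noteq> y" "\<not> E x y"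
      by (auto simp: clique_def)
    have "S - {x, y} \<subset> S" using xy by blast
    then obtain t where t: "colourable (S - {x, y}) t" "2 * t \<le> card (S - {x, y}) + w"
      using psubset.IH[of "S - {x, y}"] psubset.prems by blast
    have "card (S - {x, y}) + 2 = card S"
      using xy psubset.hyps card_Diff_subset[of "{x,y}" S] card_mono[of S "{x,y}"] by auto
    moreover have "colourable {x, y} (Suc 0)"
      using xy E_sym by (intro colourable_stable) auto
    from colourable_Un[OF t(1) this] have "colourable (S - {x, y} \<union> {x, y}) (t + Suc 0)"
      .
    moreover have "S - {x, y} \<union> {x, y} = S"
      using xy by blast
    ultimately show ?thesis using t(2) by (intro exI[of _ "Suc t"]) auto
  qed
qed

lemma exists_max_clique:
  assumes "finite S"
  obtains C where "C \<subseteq> S" "clique C" "\<And>C'. C' \<subseteq> S \<Longrightarrow> clique C' \<Longrightarrow> card C' \<le> card C"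
proof -
  have "finite (card ` {C. C \<subseteq> S \<and> clique C})" using assms by simp
  moreover have "{} \<in> {C. C \<subseteq> S \<and> clique C}" by (simp add: clique_def)
  ultimately have "Max (card ` {C. C \<subseteq> S \<and> clique C}) \<in> card ` {C. C \<subseteq> S \<and> clique C}"
    by (intro Max_in) auto
  then obtain C where C: "C \<subseteq> S" "clique C" "card C = Max (card ` {C. C \<subseteq> S \<and> clique C})"
    by auto
  show ?thesis
    using C \<open>finite (card ` _)\<close> by (intro that[of C]) auto
qed

text \<open>An anticonnected part of \<open>S\<close> is a homogeneous set, so its colours may be permuted freely; a
  part that splits into two mutually complete pieces is treated piecewise.\<close>

lemma recolour:
  assumes "finite S" "S \<subseteq> D" "D \<subseteq> T" "colours T m f"
    and g: "\<And>u v. u \<in> D \<Longrightarrow> v \<in> D \<Longrightarrow> E u v \<Longrightarrow> g u \<noteq> (g v :: nat)"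
    and complete: "\<And>s d. s \<in> S \<Longrightarrow> d \<in> D - S \<Longrightarrow> E s d"
    and twins: "\<And>v d d'. v \<in> T - D \<Longrightarrow> d \<in> D \<Longrightarrow> d' \<in> D \<Longrightarrow> \<not> E d d' \<Longrightarrow> E v d \<Longrightarrow> E v d'"
  shows "\<exists>f'. colours T m f' \<and> (\<forall>v. v \<notin> S \<longrightarrow> f' v = f v) \<and> f' ` S \<subseteq> f ` S \<and>
    card (f' ` S) \<le> card (g ` S)"
  using assms(1,2,4) complete
proof (induction S arbitrary: f rule: finite_psubset_induct)
  case (psubset S)
  show ?case
  proof (cases "\<exists>S1 S2. S1 \<noteq> {} \<and> S2 \<noteq> {} \<and> S1 \<union> S2 = S \<and> S1 \<inter> S2 = {} \<and>
      (\<forall>x\<in>S1. \<forall>y\<in>S2. E x y)")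
    case True
    then obtain S1 S2 where S: "S1 \<noteq> {}" "S2 \<noteq> {}" "S1 \<union> S2 = S" "S1 \<inter> S2 = {}"
      and "\<forall>x\<in>S1. \<forall>y\<in>S2. E x y"
      by (elim exE conjE)
    then have E12: "E x y" if "x \<in> S1" "y \<in> S2" for x y
      using that by blast
    have sub: "S1 \<subset> S" "S2 \<subset> S" using S by blast+
    have E1: "E s d" if "s \<in> S1" "d \<in> D - S1" for s d
      using that E12[of s d] psubset.prems(3)[of s d] S(3) by blast
    have E2: "E s d" if "s \<in> S2" "d \<in> D - S2" for s d
      using that E12[of d s] psubset.prems(3)[of s d] S(3) E_sym[of d s] by blast
    obtain f1 where f1: "colours T m f1" "\<And>v. v \<notin> S1 \<Longrightarrow> f1 v = f v" "f1 ` S1 \<subseteq> f ` S1"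
      "card (f1 ` S1) \<le> card (g ` S1)"
      using psubset.IH[OF sub(1) _ psubset.prems(2) E1] sub psubset.prems(1) by auto
    obtain f2 where f2: "colours T m f2" "\<And>v. v \<notin> S2 \<Longrightarrow> f2 v = f1 v" "f2 ` S2 \<subseteq> f1 ` S2"
      "card (f2 ` S2) \<le> card (g ` S2)"
      using psubset.IH[OF sub(2) _ f1(1) E2] sub psubset.prems(1) by auto
    have eq1: "f2 ` S1 = f1 ` S1"
      using f2(2) S(4) by (intro image_cong) auto
    have eq2: "f1 ` S2 = f ` S2"
      using f1(2) S(4) by (intro image_cong) auto
    have fin: "finite S1" "finite S2"
      using psubset.hyps sub finite_subset by blast+
    \<comment> \<open>Mutually complete pieces get disjoint palettes from \<open>g\<close>, so the
      numbers of colours allowed on the two pieces add up exactly to the number allowed on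
      \<open>S\<close>.\<close>
    have "g ` S1 \<inter> g ` S2 = {}"
      using g E12 sub psubset.prems(1) by blast
    then have "card (g ` S) = card (g ` S1) + card (g ` S2)"
      using fin S(3) by (metis card_Un_disjoint finite_imageI image_Un)
    moreover have "card (f2 ` S) \<le> card (f2 ` S1) + card (f2 ` S2)"
      using S(3) by (metis card_Un_le image_Un)
    moreover have "f2 ` S \<subseteq> f ` S"
      using eq1 eq2 f1(3) f2(3) unfolding S(3)[symmetric] image_Un by auto
    ultimately show ?thesis
      using f1(2,4) f2(1,2,4) eq1 S(3) by (intro exI[of _ f2] conjI) (auto simp del: Un_iff)
  next
    case False
    \<comment> \<open>A vertex outside sees all or nothing of \<open>S\<close>: by
      \<open>twins\<close>, its neighbours and non-neighbours in \<open>S\<close> would otherwise be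
      complete to each other and split \<open>S\<close>.\<close>
    have hom: "E v s'" if "v \<in> T - S" "s \<in> S" "E v s" "s' \<in> S" for v s s'
    proof (cases "v \<in> D")
      case True
      then show ?thesis using psubset.prems(3) that E_sym by blast
    next
      case vD: False
      show ?thesis
      proof (rule ccontr)
        assume ns': "\<not> E v s'"
        define X Y where "X = {x\<in>S. E v x}" and "Y = {y\<in>S. \<not> E v y}"
        have "X \<noteq> {}" "Y \<noteq> {}" "X \<union> Y = S" "X \<inter> Y = {}"
          using that ns' by (auto simp: X_def Y_def)
        moreover have "E x y" if xy: "x \<in> X" "y \<in> Y" for x y
        proof (rule ccontr)
          assume "\<not> E x y"
          moreover have "v \<in> T - D" "x \<in> D" "y \<in> D" "E v x" "\<not> E v y"
            using xy vD \<open>v \<in> T - S\<close> psubset.prems(1) by (auto simp: X_def Y_def)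
          ultimately show False using twins[of v x y] by simp
        qed
        then have "\<forall>x\<in>X. \<forall>y\<in>Y. E x y" by simp
        ultimately have "\<exists>S1 S2. S1 \<noteq> {} \<and> S2 \<noteq> {} \<and> S1 \<union> S2 = S \<and> S1 \<inter> S2 = {} \<and>
            (\<forall>x\<in>S1. \<forall>y\<in>S2. E x y)"
          by (intro exI[of _ X] exI[of _ Y] conjI)
        then show False by (rule notE[OF False])
      qed
    qed
    show ?thesis
    proof (cases "card (f ` S) \<le> card (g ` S)")
      case True
      then show ?thesis using psubset.prems(2) by blast
    next
      case card: False
      \<comment> \<open>The colours of \<open>g\<close> on \<open>S\<close> are renamed into the
        larger palette that \<open>f\<close> already uses there. A vertex outside with a neighbour
        in \<open>S\<close> sees all of \<open>S\<close>, hence avoids this whole palette, and no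
        conflict arises.\<close>
      then obtain \<phi> where \<phi>: "inj_on \<phi> (g ` S)" "\<phi> ` g ` S \<subseteq> f ` S"
        using card_le_inj[of "g ` S" "f ` S"] psubset.hyps by auto
      define f' where "f' v = (if v \<in> S then \<phi> (g v) else f v)" for v
      have im: "f' ` S = \<phi> ` g ` S"
        unfolding f'_def by (auto simp: image_image)
      have f'S: "f' s \<in> f ` S" if "s \<in> S" for s
        using im \<phi>(2) that by blast
      have cross: "f' s \<noteq> f' v" if sv: "s \<in> S" "v \<in> T - S" "E v s" for s v
      proof
        assume "f' s = f' v"
        then have "f v \<in> f ` S"
          using f'S[OF sv(1)] sv(2) by (simp add: f'_def)
        then obtain s' where s': "s' \<in> S" "f v = f s'"
          by auto
        then have "E v s'" using hom[OF sv(2,1,3)] by simp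
        moreover have "v \<in> T" "s' \<in> T"
          using sv(2) s'(1) psubset.prems(1) assms(3) by auto
        ultimately show False
          using colours_neq[OF psubset.prems(2), of v s'] s'(2) by simp
      qed
      have "colours T m f'"
        unfolding colours_def
      proof (intro conjI ballI impI)
        fix v assume "v \<in> T"
        then show "f' v < m"
          using f'S[of v] colours_less[OF psubset.prems(2)] psubset.prems(1) assms(3)
          by (cases "v \<in> S") (auto simp: f'_def)
      next
        fix u v assume uv: "u \<in> T" "v \<in> T" "E u v"
        consider "u \<in> S" "v \<in> S" | "u \<in> S" "v \<notin> S" | "u \<notin> S" "v \<in> S" | "u \<notin> S" "v \<notin> S"
          by blast
        then show "f' u \<noteq> f' v"
        proof cases
          case 1
          then have "g u \<noteq> g v" using g uv psubset.prems(1) by blast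
          then show ?thesis using 1 \<phi>(1) by (auto simp: f'_def inj_on_def)
        next
          case 2
          then show ?thesis using cross uv E_sym by blast
        next
          case 3
          then show ?thesis using cross[of v u] uv by force
        next
          case 4
          then show ?thesis using colours_neq[OF psubset.prems(2)] uv by (simp add: f'_def)
        qed
      qed
      moreover have "card (f' ` S) \<le> card (g ` S)"
        unfolding im using psubset.hyps by (intro card_image_le) simp
      moreover have "\<forall>v. v \<notin> S \<longrightarrow> f' v = f v" "f' ` S \<subseteq> f ` S"
        using f'S by (simp add: f'_def, blast)
      ultimately show ?thesis by blast
    qed
  qed
qed

lemma colourable_across_cutset:
  assumes "finite V" "K \<subseteq> V" "D \<subseteq> V" "K \<inter> D = {}"
    and col: "colourable (V - K) m" "colourable (K \<union> D) m"
    and KD: "\<And>v d. v \<in> K \<Longrightarrow> d \<in> D \<Longrightarrow> E v d"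
    and cut: "\<And>v x. v \<in> K \<Longrightarrow> x \<in> V \<Longrightarrow> E v x \<Longrightarrow> x \<in> K \<union> D"
    and twins: "\<And>v d d'. v \<in> V - K - D \<Longrightarrow> d \<in> D \<Longrightarrow> d' \<in> D \<Longrightarrow> \<not> E d d' \<Longrightarrow> E v d \<Longrightarrow> E v d'"
  shows "colourable V m"
proof -
  obtain f g where f: "colours (V - K) m f" and g: "colours (K \<union> D) m g"
    using col by (auto simp: colourable_def)
  have fin: "finite D" "finite K" using assms finite_subset by blast+
  have "\<exists>f'. colours (V - K) m f' \<and> (\<forall>v. v \<notin> D \<longrightarrow> f' v = f v) \<and> f' ` D \<subseteq> f ` D \<and>
      card (f' ` D) \<le> card (g ` D)"
    using fin f colours_neq[OF g] twins assms(3,4) by (intro recolour[of D D "V - K"]) auto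
  then obtain f' where f': "colours (V - K) m f'" "card (f' ` D) \<le> card (g ` D)"
    by blast
  have "g ` K \<inter> g ` D = {}"
    using KD colours_neq[OF g] by blast
  then have "card (g ` K) + card (g ` D) = card (g ` (K \<union> D))"
    using fin by (simp add: card_Un_disjoint image_Un)
  also have "\<dots> \<le> card {..<m}"
    using colours_less[OF g] by (intro card_mono) auto
  finally have "card (g ` K) + card (f' ` D) \<le> m" using f'(2) by simp
  moreover have "f' ` D \<subseteq> {..<m}"
    using colours_less[OF f'(1)] assms(3,4) by blast
  then have "card ({..<m} - f' ` D) = m - card (f' ` D)"
    using fin by (simp add: card_Diff_subset)
  ultimately obtain \<phi> where \<phi>: "inj_on \<phi> (g ` K)" "\<phi> ` g ` K \<subseteq> {..<m} - f' ` D"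
    using card_le_inj[of "g ` K" "{..<m} - f' ` D"] fin by fastforce
  define h where "h v = (if v \<in> K then \<phi> (g v) else f' v)" for v
  have cross: "h u \<noteq> h v" if "u \<in> K" "v \<in> V" "v \<notin> K" "E u v" for u v
    using that cut[OF that(1,2,4)] \<phi>(2) by (auto simp: h_def image_subset_iff)
  have "colours V m h"
    unfolding colours_def
  proof (intro conjI ballI impI)
    fix v assume "v \<in> V"
    then show "h v < m"
      using \<phi>(2) colours_less[OF f'(1)] by (auto simp: h_def)
  next
    fix u v assume uv: "u \<in> V" "v \<in> V" "E u v"
    consider "u \<in> K" "v \<in> K" | "u \<in> K" "v \<notin> K" | "u \<notin> K" "v \<in> K" | "u \<notin> K" "v \<notin> K"
      by blast
    then show "h u \<noteq> h v"
    proof cases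
      case 1
      then have "g u \<noteq> g v" using colours_neq[OF g] uv by blast
      then show ?thesis using 1 \<phi>(1) by (auto simp: h_def inj_on_def)
    next
      case 2
      then show ?thesis using cross uv by blast
    next
      case 3
      then show ?thesis using cross[of v u] uv E_sym by force
    next
      case 4
      then show ?thesis using colours_neq[OF f'(1)] uv by (simp add: h_def)
    qed
  qed
  then show ?thesis by (auto simp: colourable_def)
qed

section \<open>Kempe chains\<close>

definition kempe :: "'a set \<Rightarrow> ('a \<Rightarrow> nat) \<Rightarrow> nat \<Rightarrow> nat \<Rightarrow> 'a \<Rightarrow> 'a \<Rightarrow> bool" where
  "kempe S f i j x y \<longleftrightarrow> x \<in> S \<and> y \<in> S \<and> E x y \<and> f x \<in> {i, j} \<and> f y \<in> {i, j}"

lemma kempe_sym: "kempe S f i j x y \<Longrightarrow> kempe S f i j y x"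
  by (auto simp: kempe_def E_sym)

lemma kempe_reach_colour:
  assumes "(kempe S f i j)\<^sup>*\<^sup>* z v" "f z \<in> {i, j}"
  shows "f v \<in> {i, j}"
  using assms by (induction) (auto simp: kempe_def)

definition kempe_swap :: "'a set \<Rightarrow> ('a \<Rightarrow> nat) \<Rightarrow> nat \<Rightarrow> nat \<Rightarrow> 'a \<Rightarrow> 'a \<Rightarrow> nat" where
  "kempe_swap S f i j z v =
    (if (kempe S f i j)\<^sup>*\<^sup>* z v then if f v = i then j else i else f v)"

lemma kempe_swap_other: "f v \<notin> {i, j} \<Longrightarrow> f z \<in> {i, j} \<Longrightarrow> kempe_swap S f i j z v = f v"
  using kempe_reach_colour[of S f i j z v] by (auto simp: kempe_swap_def)

lemma colours_kempe_swap:
  assumes f: "colours S m f" and ij: "i < m" "j < m" "i \<noteq> j" and z: "f z \<in> {i, j}"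
  shows "colours S m (kempe_swap S f i j z)"
  unfolding colours_def
proof (intro conjI ballI impI)
  fix v assume "v \<in> S"
  then show "kempe_swap S f i j z v < m"
    using colours_less[OF f] ij by (simp add: kempe_swap_def)
next
  fix u v assume uv: "u \<in> S" "v \<in> S" "E u v"
  let ?R = "(kempe S f i j)\<^sup>*\<^sup>* z"
  have neq: "f u \<noteq> f v" using colours_neq[OF f] uv by blast
  have step: "?R y" if "?R x" "x \<in> S" "y \<in> S" "E x y" "f y \<in> {i, j}" for x y
  proof -
    have "kempe S f i j x y"
      using that kempe_reach_colour[of S f i j z x] z by (auto simp: kempe_def)
    then show ?thesis using that(1) by simp
  qed
  show "kempe_swap S f i j z u \<noteq> kempe_swap S f i j z v"
  proof (cases "f u \<in> {i, j} \<and> f v \<in> {i, j}")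
    case True
    then have "?R u \<longleftrightarrow> ?R v"
      using step[of u v] step[of v u] uv E_sym by blast
    then show ?thesis using True neq ij by (auto simp: kempe_swap_def)
  next
    case False
    then show ?thesis
      using kempe_reach_colour[of S f i j z u] kempe_reach_colour[of S f i j z v] z neq ij
      by (auto simp: kempe_swap_def)
  qed
qed

end

text \<open>A walk of least length has neither chords nor repetitions, since either would give a
  shortcut. A Kempe chain thus yields an induced path. The alternative \<open>i = j\<close> is there
  because \<open>R\<close> need not be irreflexive.\<close>

lemma shortest_path:
  assumes "R\<^sup>*\<^sup>* s t" and sym: "\<And>x y. R x y \<Longrightarrow> R y x"
  obtains p and l :: nat where "p 0 = s" "p l = t" "\<And>i. i < l \<Longrightarrow> R (p i) (p (Suc i))"
    "\<And>i j. i \<le> l \<Longrightarrow> j \<le> l \<Longrightarrow> R (p i) (p j) \<Longrightarrow> i = Suc j \<or> j = Suc i \<or> i = j"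
    "inj_on p {..l}"
proof -
  define l where "l = (LEAST l. (R ^^ l) s t)"
  have ex: "\<exists>l. (R ^^ l) s t" using assms(1) by (simp add: rtranclp_power)
  then have "(R ^^ l) s t" unfolding l_def by (rule LeastI_ex)
  then obtain p where p: "p 0 = s" "p l = t" "\<And>i. i < l \<Longrightarrow> R (p i) (p (Suc i))"
    by (auto simp: relpowp_fun_conv)
  have least: "l \<le> l'" if "(R ^^ l') s t" for l'
    unfolding l_def using that by (rule Least_le)
  have seg: "(R ^^ (j - i)) (p i) (p j)" if "i \<le> j" "j \<le> l" for i j
    unfolding relpowp_fun_conv using p(3) that by (intro exI[of _ "\<lambda>k. p (i + k)"]) auto
  have one: "(R ^^ Suc 0) x y" if "R x y" for x y using that by auto
  have short: "j \<le> Suc i" if "i \<le> l" "j \<le> l" "R (p i) (p j)" for i j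
  proof (rule ccontr)
    assume "\<not> j \<le> Suc i"
    have "(R ^^ (i + Suc 0 + (l - j))) s t"
      using seg[of 0 i] one[OF that(3)] seg[of j l] that p(1,2)
      unfolding relpowp_add by (simp del: relpowp.simps) blast
    then show False using least \<open>\<not> j \<le> Suc i\<close> that by fastforce
  qed
  have "p i \<noteq> p j" if "i < j" "j \<le> l" for i j
  proof
    assume "p i = p j"
    then have "(R ^^ (i + (l - j))) s t"
      using seg[of 0 i] seg[of j l] that p(1,2) unfolding relpowp_add by auto
    then show False using least that by fastforce
  qed
  then have "inj_on p {..l}"
    by (intro linorder_inj_onI) auto
  moreover have "i = Suc j \<or> j = Suc i \<or> i = j" if "i \<le> l" "j \<le> l" "R (p i) (p j)" for i j
    using short[OF that] short[OF that(2,1) sym[OF that(3)]] by linarith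
  ultimately show ?thesis using that p by blast
qed

text \<open>A component with all degrees at most 2 is a path or a cycle, and has at most two ends. A
  shortest path from \<open>s\<close> to \<open>t\<close> already contains all neighbours of its
  vertices, so \<open>r\<close> would be an inner vertex of it and have two neighbours.\<close>

lemma three_ends_impossible:
  assumes sym: "\<And>x y. R x y \<Longrightarrow> R y x"
    and deg2: "\<And>x a b c. R x a \<Longrightarrow> R x b \<Longrightarrow> R x c \<Longrightarrow> a = b \<or> a = c \<or> b = c"
    and ends: "\<And>x a b. x \<in> {s, t, r} \<Longrightarrow> R x a \<Longrightarrow> R x b \<Longrightarrow> a = b"
    and distinct: "s \<noteq> t" "s \<noteq> r" "t \<noteq> r"
    and reach: "R\<^sup>*\<^sup>* s t" "R\<^sup>*\<^sup>* s r"
  shows False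
proof -
  obtain p l where p: "p 0 = s" "p l = t" "\<And>i. i < l \<Longrightarrow> R (p i) (p (Suc i))" "inj_on p {..l}"
    using shortest_path[OF reach(1) sym] by metis
  have l: "l > 0" using p(1,2) distinct by (cases l) auto
  have nbrs: "R (p i) (p (i - 1))" "R (p i) (p (Suc i))" "p (i - 1) \<noteq> p (Suc i)"
    if "0 < i" "i < l" for i
    using that le_less_trans[OF diff_le_self, of i l 1] p(3)[of "i - 1"] p(3)[of i] sym inj_onD[OF p(4), of "i - 1" "Suc i"]
    by auto
  have closed: "y \<in> p ` {..l}" if "x \<in> p ` {..l}" "R x y" for x y
  proof -
    from that obtain i where i: "x = p i" "i \<le> l" by auto
    consider "i = 0" | "i = l" "l > 0" | "0 < i" "i < l" using i by fastforce
    then show ?thesis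
    proof cases
      case 1
      then have "y = p (Suc 0)" using ends[of s y "p (Suc 0)"] p(1) p(3)[of 0] that i l by auto
      then show ?thesis using l by auto
    next
      case 2
      then have "y = p (l - 1)" using ends[of t y "p (l - 1)"] p(2) p(3)[of "l - 1"] sym that i by simp
      then show ?thesis by auto
    next
      case 3
      then have "y = p (i - 1) \<or> y = p (Suc i)"
        using deg2[of "p i" y "p (i - 1)" "p (Suc i)"] nbrs[OF 3] that i by simp
      then show ?thesis using 3 by auto
    qed
  qed
  have "r \<in> p ` {..l}"
    using reach(2)
  proof induction
    case base
    then show ?case using p(1) by force
  next
    case (step y z)
    then show ?case using closed by blast
  qed
  then obtain i where i: "r = p i" "i \<le> l" by auto
  then have "0 < i" "i < l" using p(1,2) distinct by (auto intro: Nat.gr0I le_neq_implies_less)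
  then show False using nbrs[of i] ends[of r] i by blast
qed

section \<open>Odd holes in graphs without chairs and kites\<close>

text \<open>Roles of the variables: the chair has centre \<open>b\<close>, leaves \<open>a\<close>
  and \<open>c\<close>, and the long leg \<open>d\<close>, \<open>e\<close>. In the kite,
  \<open>p q\<close> is the edge common to the two triangles, \<open>r\<close> and \<open>s\<close>
  are the nonadjacent vertices of the diamond, and \<open>t\<close> is pendant at \<open>r\<close>.
  All distinctness other than \<open>a \<noteq> c\<close> follows from the adjacencies.\<close>

locale chair_kite_free = sgraph E for E :: "'a \<Rightarrow> 'a \<Rightarrow> bool" +
  fixes V :: "'a set"
  assumes finite_V: "finite V"
    and no_chair: "\<lbrakk>b \<in> V; a \<in> V; c \<in> V; d \<in> V; e \<in> V; E b a; E b c; E b d; E d e;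
      \<not> E a c; \<not> E a d; \<not> E a e; \<not> E c d; \<not> E c e; \<not> E b e; a \<noteq> c\<rbrakk> \<Longrightarrow> False"
    and no_kite: "\<lbrakk>p \<in> V; q \<in> V; r \<in> V; s \<in> V; t \<in> V; E p q; E p r; E q r; E p s; E q s; E r t;
      \<not> E r s; \<not> E t p; \<not> E t q; \<not> E t s\<rbrakk> \<Longrightarrow> False"
begin

text \<open>The vertices of a hole are indexed by the integers, periodically, so that rotations and
  reflections are translations and negation of the index.\<close>

definition hole :: "int \<Rightarrow> (int \<Rightarrow> 'a) \<Rightarrow> bool" where
  "hole n h \<longleftrightarrow> 5 \<le> n \<and> odd n \<and> (\<forall>i. h i \<in> V) \<and> (\<forall>i. h (i + n) = h i) \<and>
    (\<forall>i j. i < j \<longrightarrow> j < i + n \<longrightarrow> (E (h i) (h j) \<longleftrightarrow> j = i + 1 \<or> j = i + n - 1))"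

definition complete_to :: "(int \<Rightarrow> 'a) \<Rightarrow> 'a \<Rightarrow> bool" where
  "complete_to h v \<longleftrightarrow> (\<forall>i. E v (h i))"

definition anticomplete_to :: "(int \<Rightarrow> 'a) \<Rightarrow> 'a \<Rightarrow> bool" where
  "anticomplete_to h v \<longleftrightarrow> (\<forall>i. \<not> E v (h i))"

lemma hole_shift:
  assumes "hole n h"
  shows "hole n (\<lambda>i. h (i + s))"
proof -
  have "h (i + n + s) = h (i + s)" for i
    using assms unfolding hole_def by (metis add.assoc add.commute)
  moreover have "E (h (i + s)) (h (j + s)) \<longleftrightarrow> j = i + 1 \<or> j = i + n - 1"
    if "i < j" "j < i + n" for i j
    using assms that unfolding hole_def by auto
  ultimately show ?thesis using assms unfolding hole_def by simp
qed

lemma hole_reflect: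
  assumes "hole n h"
  shows "hole n (\<lambda>i. h (- i))"
proof -
  have "h (- (i + n)) = h (- i)" for i
    using assms unfolding hole_def by (metis add.commute add_uminus_conv_diff diff_add_cancel minus_add_distrib)
  moreover have "E (h (- i)) (h (- j)) \<longleftrightarrow> j = i + 1 \<or> j = i + n - 1" if "i < j" "j < i + n" for i j
  proof -
    have "E (h (- j)) (h (- i)) \<longleftrightarrow> - i = - j + 1 \<or> - i = - j + n - 1"
      using assms that unfolding hole_def by simp
    then show ?thesis using E_commute by auto
  qed
  ultimately show ?thesis using assms unfolding hole_def by simp
qed

context
  fixes n h assumes hole: "hole n h"
begin

lemma hole_V [simp]: "h i \<in> V"
  and hole_period: "h (i + n) = h i"
  and hole_length: "5 \<le> n"
  and hole_odd: "odd n"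
  using hole by (auto simp: hole_def)

lemma hole_adj: "j = i + 1 \<Longrightarrow> E (h i) (h j)" "i = j + 1 \<Longrightarrow> E (h i) (h j)"
  and hole_nonadj: "i + 1 < j \<Longrightarrow> j + 1 < i + n \<Longrightarrow> \<not> E (h i) (h j)"
    "j + 1 < i \<Longrightarrow> i + 1 < j + n \<Longrightarrow> \<not> E (h i) (h j)"
proof -
  have "E (h i) (h j) \<longleftrightarrow> j = i + 1 \<or> j = i + n - 1" if "i < j" "j < i + n" for i j
    using hole that by (simp add: hole_def)
  moreover from this[of j i]
  have "E (h i) (h j) \<longleftrightarrow> i = j + 1 \<or> i = j + n - 1" if "j < i" "i < j + n"
    using that E_commute by blast
  ultimately show "j = i + 1 \<Longrightarrow> E (h i) (h j)" "i = j + 1 \<Longrightarrow> E (h i) (h j)"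
    "i + 1 < j \<Longrightarrow> j + 1 < i + n \<Longrightarrow> \<not> E (h i) (h j)"
    "j + 1 < i \<Longrightarrow> i + 1 < j + n \<Longrightarrow> \<not> E (h i) (h j)"
    using hole_length by auto
qed

lemma hole_adj_wrap: "j = i + n - 1 \<Longrightarrow> E (h i) (h j)"
  using hole_adj(2)[of i "i - 1"] hole_period[of "i - 1"] by (simp add: add.commute add_diff_eq)

lemma hole_neq:
  assumes "i < j" "j < i + n"
  shows "h i \<noteq> h j" "h j \<noteq> h i"
proof -
  have "h i \<noteq> h j"
  proof
    assume eq: "h i = h j"
    have "\<not> E (h i) (h j)" by (simp add: eq)
    then have j: "j \<noteq> i + 1" "j \<noteq> i + n - 1" using hole_adj hole_adj_wrap by blast+
    have "E (h (i + 1)) (h j)" "E (h (i - 1)) (h j)"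
      using hole_adj(1)[of i "i - 1"] hole_adj(2)[of "i + 1" i] eq by simp_all
    then have "\<not> i + 2 < j" "\<not> j < i + n - 2"
      using hole_nonadj(1)[of "i + 1" j] hole_nonadj(1)[of "i - 1" j] assms j by auto
    then show False using j assms hole_length by linarith
  qed
  then show "h i \<noteq> h j" "h j \<noteq> h i" by simp_all
qed

lemmas hole_simps = hole_adj hole_nonadj hole_neq

text \<open>Otherwise \<open>h (i + 2)\<close> is pendant at \<open>h (i + 1)\<close> in the diamond
  formed by \<open>v\<close> and the three vertices.\<close>

lemma three_consecutive:
  assumes "v \<in> V" "E v (h (i - 1))" "E v (h i)" "E v (h (i + 1))"
  shows "E v (h (i + 2))"
  using no_kite[of v "h i" "h (i + 1)" "h (i - 1)" "h (i + 2)"] assms hole_length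
  by (simp add: hole_simps E_commute) blast

text \<open>Forward steps suffice: a multiple of the period moves \<open>j\<close> to the right of
  \<open>i\<close>.\<close>

lemma all_by_steps:
  assumes "P (i :: int)" "\<And>j. P j \<Longrightarrow> P (j + 1)" "\<And>j. P (j + n) \<longleftrightarrow> P j"
  shows "P j"
proof -
  have up: "P (i + int k)" for k
  proof (induction k)
    case (Suc k)
    then show ?case using assms(2)[of "i + int k"] by (simp add: ac_simps)
  qed (use assms(1) in simp)
  have per: "P (j' + int k * n) \<longleftrightarrow> P j'" for j' k
  proof (induction k)
    case (Suc k)
    have "P (j' + int (Suc k) * n) \<longleftrightarrow> P (j' + int k * n + n)"
      by (simp add: algebra_simps)
    then show ?case using Suc assms(3) by blast
  qed simp
  define k where "k = nat (\<bar>j\<bar> + \<bar>i\<bar>)"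
  have "int k \<le> int k * n" using hole_length by (simp add: mult_le_cancel_left1)
  then have "j + int k * n - i \<ge> 0" unfolding k_def by linarith
  then have "P (j + int k * n)"
    using up[of "nat (j + int k * n - i)"] by simp
  then show ?thesis using per by blast
qed

text \<open>This is where oddness enters: (n + 1) / 2 double steps advance by n + 1, which is a
  single step up to the period.\<close>

lemma next_by_double_steps:
  assumes "P (i :: int)" "\<And>j. P j \<Longrightarrow> P (j + 2)" "\<And>j. P (j + n) \<longleftrightarrow> P j"
  shows "P (i + 1)"
proof -
  have up: "P (i + 2 * int k)" for k
  proof (induction k)
    case (Suc k)
    then show ?case using assms(2)[of "i + 2 * int k"] by (simp add: ac_simps)
  qed (use assms(1) in simp)
  obtain q where q: "n = 2 * q + 1" using hole_odd by (auto elim: oddE)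
  have eq: "i + 2 * int (nat (q + 1)) = i + 1 + n" using q hole_length by simp
  from up[of "nat (q + 1)"] show ?thesis unfolding eq assms(3) .
qed

lemma three_consecutive_complete:
  assumes "v \<in> V" "E v (h (i - 1))" "E v (h i)" "E v (h (i + 1))"
  shows "complete_to h v"
proof -
  let ?P = "\<lambda>j. E v (h (j - 1)) \<and> E v (h j) \<and> E v (h (j + 1))"
  have "?P j" for j
  proof (rule all_by_steps[of ?P i])
    show "?P i" using assms by simp
    show "?P (j + 1)" if "?P j" for j
      using that three_consecutive[of v j] assms(1) by (simp add: add.assoc)
    show "?P (j + n) \<longleftrightarrow> ?P j" for j
      using hole_period[of j] hole_period[of "j - 1"] hole_period[of "j + 1"]
      by (simp add: algebra_simps)
  qed
  then show ?thesis by (auto simp: complete_to_def)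
qed

lemma boundary:
  assumes "E v (h i)" "\<not> E v (h j)"
  shows "\<exists>k. E v (h k) \<and> \<not> E v (h (k + 1))"
proof (rule ccontr)
  assume "\<not> ?thesis"
  then have "E v (h j)"
    by (intro all_by_steps[of "\<lambda>k. E v (h k)" i j]) (simp_all add: assms hole_period)
  then show False using assms(2) by simp
qed

text \<open>Going around the hole, a neighbour of \<open>v\<close> cannot be followed by two non-neighbours, by the kite
  containing \<open>d\<close>; an odd hole cannot alternate.\<close>

lemma consecutive_pair:
  assumes v: "v \<in> V" "E v (h i)" and d: "d \<in> V" "complete_to h d" "\<not> E v d"
  shows "\<exists>k. E v (h k) \<and> E v (h (k + 1))"
proof (rule ccontr)
  assume "\<not> ?thesis"
  then have no: "\<not> E v (h (k + 1))" if "E v (h k)" for k using that by blast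
  have "E v (h (j + 2))" if "E v (h j)" for j
    using no_kite[of d "h (j + 1)" "h j" "h (j + 2)" v] no[OF that] that v d hole_length
    by (auto simp: hole_simps complete_to_def E_commute)
  then have "E v (h (i + 1))"
    using next_by_double_steps[of "\<lambda>j. E v (h j)" i] v hole_period by simp
  then show False using no v by blast
qed

end

end

section \<open>Attachments to a 5-hole that has a flap\<close>

locale five_hole = chair_kite_free E V for E :: "'a \<Rightarrow> 'a \<Rightarrow> bool" and V +
  fixes c0 c1 c2 c3 c4 :: 'a
  assumes verts: "c0 \<in> V" "c1 \<in> V" "c2 \<in> V" "c3 \<in> V" "c4 \<in> V"
    and adj: "E c0 c1" "E c1 c2" "E c2 c3" "E c3 c4" "E c4 c0"
    and nonadj: "\<not> E c0 c2" "\<not> E c1 c3" "\<not> E c2 c4" "\<not> E c3 c0" "\<not> E c4 c1"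
begin

lemma rotate: "five_hole E V c1 c2 c3 c4 c0"
  using verts adj nonadj by unfold_locales auto

text \<open>In the complement, a flap is a vertex with exactly two neighbours on the hole, which are
  consecutive.\<close>

definition flap :: "'a \<Rightarrow> bool" where
  "flap v \<longleftrightarrow> v \<in> V \<and> E v c0 \<and> \<not> E v c1 \<and> E v c2 \<and> E v c3 \<and> \<not> E v c4"

text \<open>If adjacent, \<open>x\<close> and \<open>c2\<close> would be leaves of a chair centred
  at \<open>f\<close> with long leg \<open>c0\<close>, \<open>c4\<close>.\<close>

lemma flap_anticomplete:
  assumes "flap f" "x \<in> V" "\<not> E x c0" "\<not> E x c1" "\<not> E x c2" "\<not> E x c3" "\<not> E x c4"
  shows "\<not> E f x"
  using no_chair[of f x c2 c0 c4] assms verts adj nonadj unfolding flap_def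
  by (auto simp: E_commute)

text \<open>Two adjacent flaps form a diamond with \<open>c0\<close> and \<open>c2\<close>, to which
  \<open>c4\<close> is pendant at \<open>c0\<close>.\<close>

lemma flaps_stable:
  assumes "flap f" "flap g"
  shows "\<not> E f g"
  using no_kite[of f g c0 c2 c4] assms verts adj nonadj unfolding flap_def
  by (auto simp: E_commute)

text \<open>Each of \<open>x0\<close> to \<open>x21\<close> forbids one adjacency pattern of
  \<open>v\<close> by a single chair or kite, and propositional reasoning does the rest. The flap
  \<open>f\<close> is essential: a vertex adjacent to exactly two consecutive vertices of the hole
  makes no chair or kite with the hole alone, and only the clauses using \<open>f\<close> rule it
  out.\<close>

lemma attachment:
  assumes "flap f" and v: "v \<in> V" "v \<notin> {c0, c1, c2, c3, c4}"
  shows "E v c0 \<and> E v c1 \<and> E v c2 \<and> E v c3 \<and> E v c4 \<or>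
    \<not> E v c0 \<and> \<not> E v c1 \<and> \<not> E v c2 \<and> \<not> E v c3 \<and> \<not> E v c4 \<or>
    flap v \<or> five_hole.flap E V c1 c2 c3 c4 c0 v \<or> five_hole.flap E V c2 c3 c4 c0 c1 v \<or>
    five_hole.flap E V c3 c4 c0 c1 c2 v \<or> five_hole.flap E V c4 c0 c1 c2 c3 v"
proof -
  interpret r1: five_hole E V c1 c2 c3 c4 c0 by (rule rotate)
  interpret r2: five_hole E V c2 c3 c4 c0 c1 by (rule r1.rotate)
  interpret r3: five_hole E V c3 c4 c0 c1 c2 by (rule r2.rotate)
  interpret r4: five_hole E V c4 c0 c1 c2 c3 by (rule r3.rotate)
  have f: "f \<in> V" "E f c0" "\<not> E f c1" "E f c2" "E f c3" "\<not> E f c4"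
    using assms(1) by (auto simp: flap_def)
  have ne: "v \<noteq> c0" "v \<noteq> c1" "v \<noteq> c2" "v \<noteq> c3" "v \<noteq> c4" "c1 \<noteq> c4" "c1 \<noteq> f" "c4 \<noteq> f"
    using v(2) adj nonadj f E_sym by auto
  note facts = v(1) verts adj nonadj f ne
  have x0: "\<not> (\<not> E v c0 \<and> \<not> E v c1 \<and> E v c4 \<and> \<not> E v f)"
    using no_chair[of c0 c1 f c4 v] facts by (auto simp: E_commute)
  have x1: "\<not> (E v c0 \<and> \<not> E v c1 \<and> \<not> E v c3 \<and> \<not> E v c4)"
    using no_chair[of c0 c1 v c4 c3] facts by (auto simp: E_commute)
  have x2: "\<not> (\<not> E v c0 \<and> E v c1 \<and> \<not> E v c4 \<and> \<not> E v f)"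
    using no_chair[of c0 c4 f c1 v] facts by (auto simp: E_commute)
  have x3: "\<not> (E v c0 \<and> E v c1 \<and> \<not> E v c2 \<and> E v c4)"
    using no_kite[of c0 v c1 c4 c2] facts by (auto simp: E_commute)
  have x4: "\<not> (E v c0 \<and> E v c1 \<and> E v c2 \<and> \<not> E v c4)"
    using no_kite[of c1 v c0 c2 c4] facts by (auto simp: E_commute)
  have x5: "\<not> (\<not> E v c1 \<and> \<not> E v c2 \<and> E v c3 \<and> \<not> E v c4)"
    using no_chair[of c3 c4 v c2 c1] facts by (auto simp: E_commute)
  have x6: "\<not> (E v c0 \<and> \<not> E v c1 \<and> E v c3 \<and> E v c4)"
    using no_kite[of c4 v c0 c3 c1] facts by (auto simp: E_commute)
  have x7: "\<not> (\<not> E v c0 \<and> E v c1 \<and> \<not> E v c2 \<and> \<not> E v c3)"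
    using no_chair[of c1 c0 v c2 c3] facts by (auto simp: E_commute)
  have x8: "\<not> (\<not> E v c0 \<and> \<not> E v c1 \<and> E v c2 \<and> \<not> E v c3)"
    using no_chair[of c2 c3 v c1 c0] facts by (auto simp: E_commute)
  have x9: "\<not> (\<not> E v c0 \<and> E v c1 \<and> E v c2 \<and> E v c3)"
    using no_kite[of c2 v c1 c3 c0] facts by (auto simp: E_commute)
  have x10: "\<not> (E v c0 \<and> E v c1 \<and> \<not> E v c3 \<and> E v c4)"
    using no_kite[of c0 v c4 c1 c3] facts by (auto simp: E_commute)
  have x11: "\<not> (\<not> E v c0 \<and> \<not> E v c1 \<and> \<not> E v c4 \<and> E v f)"
    using no_chair[of c0 c1 c4 f v] facts by (auto simp: E_commute)
  have x12: "\<not> (E v c0 \<and> \<not> E v c1 \<and> \<not> E v c3 \<and> \<not> E v f)"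
    using no_chair[of c0 c1 v f c3] facts by (auto simp: E_commute)
  have x13: "\<not> (E v c0 \<and> \<not> E v c2 \<and> \<not> E v c4 \<and> \<not> E v f)"
    using no_chair[of c0 c4 v f c2] facts by (auto simp: E_commute)
  have x14: "\<not> (E v c0 \<and> E v c1 \<and> \<not> E v c3 \<and> E v f)"
    using no_kite[of c0 v f c1 c3] facts by (auto simp: E_commute)
  have x15: "\<not> (E v c0 \<and> \<not> E v c2 \<and> E v c4 \<and> E v f)"
    using no_kite[of c0 v f c4 c2] facts by (auto simp: E_commute)
  have x16: "\<not> (\<not> E v c0 \<and> E v c1 \<and> \<not> E v c2 \<and> \<not> E v c4)"
    using no_chair[of c1 c2 v c0 c4] facts by (auto simp: E_commute)
  have x17: "\<not> (\<not> E v c0 \<and> E v c2 \<and> E v c3 \<and> \<not> E v f)"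
    using no_kite[of c2 c3 f v c0] facts by (auto simp: E_commute)
  have x18: "\<not> (E v c2 \<and> \<not> E v c3 \<and> \<not> E v c4 \<and> E v f)"
    using no_kite[of c2 f c3 v c4] facts by (auto simp: E_commute)
  have x19: "\<not> (\<not> E v c1 \<and> \<not> E v c2 \<and> E v c3 \<and> E v f)"
    using no_kite[of c3 f c2 v c1] facts by (auto simp: E_commute)
  have x20: "\<not> (\<not> E v c1 \<and> E v c2 \<and> E v c3 \<and> E v c4)"
    using no_kite[of c3 v c2 c4 c1] facts by (auto simp: E_commute)
  have x21: "\<not> (\<not> E v c0 \<and> \<not> E v c2 \<and> \<not> E v c3 \<and> E v c4)"
    using no_chair[of c4 c0 v c3 c2] facts by (auto simp: E_commute)
  show ?thesis
    unfolding flap_def r1.flap_def r2.flap_def r3.flap_def r4.flap_def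
    using v(1) x0 x1 x2 x3 x4 x5 x6 x7 x8 x9 x10 x11 x12 x13 x14 x15 x16 x17 x18 x19 x20 x21 by argo
qed

end

section \<open>Minimal counterexamples\<close>

text \<open>\<Delta> and \<open>w\<close> are mere upper bounds, so they pass unchanged to induced
  subgraphs. Joins are excluded by a separate assumption because they are reduced to a part with
  smaller parameters, which \<open>critical\<close>, speaking of the same \<open>m\<close>, cannot
  express.\<close>

locale minimal_counterexample = chair_kite_free E V for E :: "'a \<Rightarrow> 'a \<Rightarrow> bool" and V +
  fixes \<Delta> w m :: nat
  assumes degree: "v \<in> V \<Longrightarrow> card {x \<in> V. E v x} \<le> \<Delta>"
    and clique_bound: "C \<subseteq> V \<Longrightarrow> clique C \<Longrightarrow> card C \<le> w"
    and bound: "\<Delta> + w + 1 \<le> 2 * m"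
    and not_colourable: "\<not> colourable V m"
    and critical: "S \<subset> V \<Longrightarrow> colourable S m"
    and no_join: "D \<subseteq> V \<Longrightarrow> D \<noteq> {} \<Longrightarrow> D \<noteq> V \<Longrightarrow> \<exists>x\<in>D. \<exists>y\<in>V - D. \<not> E x y"
begin

section \<open>Vertices complete or anticomplete to an odd hole\<close>

text \<open>In an inclusion-minimal such piece \<open>K\<close>, every vertex is adjacent to all of
  the boundary \<open>D\<close>, and the pair \<open>K\<close>, \<open>D\<close> then meets the
  conditions of \<open>colourable_across_cutset\<close>. Criticality supplies the two colourings,
  the hole itself lying outside \<open>K \<union> D\<close>.\<close>

lemma no_small_cut:
  assumes hole: "hole n h" and K0: "K0 \<subseteq> V" "K0 \<noteq> {}" "\<And>x. x \<in> K0 \<Longrightarrow> anticomplete_to h x"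
    and closed0: "\<And>x y. x \<in> K0 \<Longrightarrow> y \<in> V \<Longrightarrow> E x y \<Longrightarrow> y \<in> K0 \<or> complete_to h y"
  shows False
proof -
  note [simp] = hole_V[OF hole]
  note hs = hole_simps[OF hole]
  have n: "5 \<le> n" by (rule hole_length[OF hole])
  define good where "good K \<longleftrightarrow> K \<subseteq> K0 \<and> K \<noteq> {} \<and>
    (\<forall>x\<in>K. \<forall>y\<in>V. E x y \<longrightarrow> y \<in> K \<or> complete_to h y)" for K
  have "good K0" using K0 closed0 by (auto simp: good_def)
  moreover have "finite {K. good K}"
    using finite_V K0(1) finite_subset[of K0 V] by (auto simp: good_def)
  ultimately obtain K where K: "good K" and min: "\<And>K'. good K' \<Longrightarrow> K' \<subseteq> K \<Longrightarrow> K' = K"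
    using finite_has_minimal[of "{K. good K}"] by auto
  have KV: "K \<subseteq> V" and Kne: "K \<noteq> {}" and anti: "\<And>x i. x \<in> K \<Longrightarrow> \<not> E x (h i)"
    and closed: "\<And>x y. x \<in> K \<Longrightarrow> y \<in> V \<Longrightarrow> E x y \<Longrightarrow> y \<in> K \<or> complete_to h y"
    using K K0 by (auto simp: good_def anticomplete_to_def)
  define D where "D = {d \<in> V. complete_to h d \<and> (\<exists>x\<in>K. E d x)}"
  have Dh: "E d (h i)" if "d \<in> D" for d i
    using that by (simp add: D_def complete_to_def)
  \<comment> \<open>A chair centred at \<open>d\<close> with leaves \<open>h 0\<close>,
    \<open>h 2\<close> and long leg \<open>x\<close>, \<open>y\<close> shows that the neighbours of
    \<open>d\<close> in \<open>K\<close> are closed under adjacency within \<open>K\<close>.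
    Minimality of \<open>K\<close> makes them all of \<open>K\<close>.\<close>
  have KD: "E x d" if x: "x \<in> K" and d: "d \<in> D" for x d
  proof -
    have "E d y" if "x \<in> K" "E d x" "y \<in> K" "E x y" for x y
      using no_chair[of d "h 0" "h 2" x y] that d KV anti[of x] anti[of y] Dh[OF d] n
      by (auto simp: hs E_commute D_def subset_iff)
    then have "good {x \<in> K. E d x}"
      using K d KV unfolding good_def D_def by blast
    then have "{x \<in> K. E d x} = K" by (rule min) auto
    then show ?thesis using x E_sym by blast
  qed
  have "colourable V m"
  proof (rule colourable_across_cutset[OF finite_V KV, of D])
    show "D \<subseteq> V" by (auto simp: D_def)
    show "K \<inter> D = {}"
      using anti by (auto simp: D_def complete_to_def)
    show "colourable (V - K) m"
      using Kne KV by (intro critical) auto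
    have "h 0 \<notin> K \<union> D"
      using anti[of "h 0" 1] Dh[of "h 0" 0] hole_adj(1)[OF hole, of 1 0] by auto
    then show "colourable (K \<union> D) m"
      using KV by (intro critical) (auto simp: D_def)
    show "E x d" if "x \<in> K" "d \<in> D" for x d using KD that .
    show "y \<in> K \<union> D" if "x \<in> K" "y \<in> V" "E x y" for x y
      using closed[OF that] that E_sym by (auto simp: D_def)
  next
    \<comment> \<open>If \<open>v\<close> sees the hole, it sees two consecutive vertices of it,
      which form a diamond with \<open>d'\<close> and \<open>v\<close>, and \<open>x\<close> is
      pendant at \<open>d'\<close>. If not, \<open>h 0\<close>, \<open>h 1\<close>,
      \<open>d\<close>, \<open>d'\<close> form a diamond and \<open>v\<close> is pendant at
      \<open>d\<close>.\<close>
    fix v d d' assume vd: "v \<in> V - K - D" "d \<in> D" "d' \<in> D" "\<not> E d d'" "E v d"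
    obtain x where x: "x \<in> K" using Kne by blast
    have "\<not> E x v"
    proof
      assume "E x v"
      then have "complete_to h v" "E v x" using closed[OF x, of v] vd(1) E_sym by simp_all
      then show False using vd(1) x unfolding D_def by blast
    qed
    moreover have "x \<in> V" "E x d" "E x d'" using x KV KD vd by auto
    ultimately have xs: "x \<in> V" "E x d" "E x d'" "\<not> E x v" by simp_all
    have ds: "d \<in> V" "d' \<in> V" "complete_to h d'" using vd by (auto simp: D_def)
    show "E v d'"
    proof (rule ccontr)
      assume nvd: "\<not> E v d'"
      show False
      proof (cases "\<exists>i. E v (h i)")
        case True
        then obtain k where k: "E v (h k)" "E v (h (k + 1))"
          using consecutive_pair[OF hole, of v _ d'] vd(1) ds nvd by auto
        show False
          using no_kite[of "h k" "h (k + 1)" d' v x] k xs ds vd nvd Dh[of d'] anti[OF x] n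
          by (auto simp: hs E_commute)
      next
        case False
        then show False
          using no_kite[of "h 0" "h 1" d d' v] ds vd nvd Dh[of d'] Dh[of d] n
          by (auto simp: hs E_commute)
      qed
    qed
  qed
  then show False using not_colourable by blast
qed

text \<open>The non-neighbours of \<open>h 0\<close>, with \<open>h 0\<close> itself, fall into two
  stable sets, while its neighbourhood contains a stable set of size three. Two colours, one colour,
  and a colouring of the remaining neighbours by \<open>colourable_half\<close> together stay within
  \<open>m\<close>.\<close>

lemma no_flap:
  assumes "hole 5 h" "v \<in> V" "E v (h 0)" "\<not> E v (h 1)" "E v (h 2)" "E v (h 3)" "\<not> E v (h 4)"
  shows False
proof -
  note hole = assms(1)
  note [simp] = hole_V[OF hole]
  note hs = hole_simps[OF hole] hole_adj_wrap[OF hole]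
  interpret r0: five_hole E V "h 0" "h 1" "h 2" "h 3" "h 4"
    by unfold_locales (auto simp: hs E_commute[of "h 4"] E_commute[of "h 3" "h 0"])
  interpret r1: five_hole E V "h 1" "h 2" "h 3" "h 4" "h 0" by (rule r0.rotate)
  interpret r2: five_hole E V "h 2" "h 3" "h 4" "h 0" "h 1" by (rule r1.rotate)
  interpret r3: five_hole E V "h 3" "h 4" "h 0" "h 1" "h 2" by (rule r2.rotate)
  interpret r4: five_hole E V "h 4" "h 0" "h 1" "h 2" "h 3" by (rule r3.rotate)
  have v: "r0.flap v" using assms by (simp add: r0.flap_def)
  have hole_case: "(\<forall>i. P (h i)) \<longleftrightarrow> P (h 0) \<and> P (h 1) \<and> P (h 2) \<and> P (h 3) \<and> P (h 4)" for P
  proof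
    assume P: "P (h 0) \<and> P (h 1) \<and> P (h 2) \<and> P (h 3) \<and> P (h 4)"
    \<comment> \<open>A window of five consecutive values is preserved by a unit step, since the
      entering vertex equals the leaving one.\<close>
    let ?Q = "\<lambda>i. P (h i) \<and> P (h (i + 1)) \<and> P (h (i + 2)) \<and> P (h (i + 3)) \<and> P (h (i + 4))"
    have per: "h (5 + i) = h i" for i
      using hole_period[OF hole, of i] by (simp add: add.commute)
    have "?Q i" for i
    proof (rule all_by_steps[OF hole, of ?Q 0])
      show "?Q 0" using P by simp
      show "?Q (i + 1)" if "?Q i" for i
        using that per[of i] by (simp add: add.commute)
      show "?Q (i + 5) \<longleftrightarrow> ?Q i" for i
        using per[of i] per[of "i + 1"] per[of "i + 2"] per[of "i + 3"] per[of "i + 4"]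
        by (simp add: add.commute)
    qed
    then show "\<forall>i. P (h i)" by blast
  qed blast
  have anti_iff: "anticomplete_to h x \<longleftrightarrow>
      \<not> E x (h 0) \<and> \<not> E x (h 1) \<and> \<not> E x (h 2) \<and> \<not> E x (h 3) \<and> \<not> E x (h 4)" for x
    unfolding anticomplete_to_def by (rule hole_case)
  have compl_iff: "complete_to h x \<longleftrightarrow>
      E x (h 0) \<and> E x (h 1) \<and> E x (h 2) \<and> E x (h 3) \<and> E x (h 4)" for x
    unfolding complete_to_def by (rule hole_case)
  have attach: "complete_to h x \<or> anticomplete_to h x \<or>
      r0.flap x \<or> r1.flap x \<or> r2.flap x \<or> r3.flap x \<or> r4.flap x"
    if "x \<in> V" "x \<notin> {h 0, h 1, h 2, h 3, h 4}" for x
    unfolding compl_iff anti_iff using r0.attachment[OF v that] by blast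
  have no_anti: "\<not> anticomplete_to h x" if "x \<in> V" for x
  proof
    assume "anticomplete_to h x"
    show False
    proof (rule no_small_cut[OF hole, of "{x \<in> V. anticomplete_to h x}"])
      fix x y assume xy: "x \<in> {x \<in> V. anticomplete_to h x}" "y \<in> V" "E x y"
      then have x: "x \<in> V" "\<not> E x (h 0)" "\<not> E x (h 1)" "\<not> E x (h 2)" "\<not> E x (h 3)" "\<not> E x (h 4)"
        by (auto simp: anti_iff)
      have "\<not> r0.flap y" "\<not> r1.flap y" "\<not> r2.flap y" "\<not> r3.flap y" "\<not> r4.flap y"
        using r0.flap_anticomplete[of y x] r1.flap_anticomplete[of y x] r2.flap_anticomplete[of y x]
          r3.flap_anticomplete[of y x] r4.flap_anticomplete[of y x] x xy(3) E_sym[OF xy(3)] by blast+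
      moreover have "y \<notin> {h 0, h 1, h 2, h 3, h 4}" using x xy(3) by auto
      ultimately show "y \<in> {x \<in> V. anticomplete_to h x} \<or> complete_to h y"
        using attach[OF xy(2)] xy(2) by blast
    qed (use that \<open>anticomplete_to h x\<close> in auto)
  qed
  let ?N = "{x \<in> V. E (h 0) x}"
  have part: "x \<in> ?N \<or> x = h 0 \<or> x = h 2 \<or> x = h 3 \<or> r1.flap x \<or> r4.flap x" if "x \<in> V" for x
  proof (cases "x \<in> {h 0, h 1, h 2, h 3, h 4}")
    case True
    then show ?thesis using r0.adj r0.verts E_sym by auto
  next
    case False
    then show ?thesis
      using attach[OF that False] no_anti[OF that] that E_sym
      by (auto simp: compl_iff r0.flap_def r2.flap_def r3.flap_def)
  qed
  \<comment> \<open>Only flaps of \<open>r1\<close>, which miss \<open>h 0\<close> and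
    \<open>h 2\<close>, and flaps of \<open>r4\<close>, which miss \<open>h 0\<close> and
    \<open>h 3\<close>, are non-neighbours of \<open>h 0\<close> off the hole. Flaps of one kind
    form a stable set, also together with the hole vertices that they miss.\<close>
  define A where "A = {h 0, h 2} \<union> {x. r1.flap x}"
  define B where "B = {h 3} \<union> {x. r4.flap x}"
  have "\<not> E x (h 0)" "\<not> E (h 0) x" "\<not> E x (h 2)" "\<not> E (h 2) x" if "r1.flap x" for x
    using that E_sym[of "h 0" x] E_sym[of "h 2" x] by (auto simp: r1.flap_def)
  then have "colourable A (Suc 0)"
    using r1.flaps_stable E_irrefl[of "h 0"] E_irrefl[of "h 2"] r0.nonadj(1) E_sym[of "h 2" "h 0"] unfolding A_def
    by (intro colourable_stable) blast
  moreover have "\<not> E x (h 3)" "\<not> E (h 3) x" if "r4.flap x" for x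
    using that E_sym[of "h 3" x] by (auto simp: r4.flap_def)
  then have "colourable B (Suc 0)"
    using r4.flaps_stable E_irrefl[of "h 3"] unfolding B_def by (intro colourable_stable) blast
  ultimately have AB: "colourable (A \<union> B) 2"
    using colourable_Un[of A "Suc 0" B "Suc 0"] by (simp add: numeral_2_eq_2)
  define T where "T = {v, h 1, h 4}"
  have Tst: "colourable T (Suc 0)"
    using assms r0.nonadj E_sym[of "h 1"] E_sym[of "h 4"] unfolding T_def
    by (intro colourable_stable) auto
  have TN: "T \<subseteq> ?N"
    using assms r0.verts r0.adj E_sym[of _ "h 0"] by (auto simp: T_def)
  have "v \<noteq> h 1" "v \<noteq> h 4" "h 1 \<noteq> h 4"
    using assms(5,6) r0.nonadj(2,3) E_sym[of "h 4" "h 2"] hole_neq(1)[OF hole, of 1 4] by auto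
  then have cardT: "card T = 3" by (simp add: T_def)
  have finN: "finite ?N" using finite_V by simp
  have "card C \<le> w - 1" if "C \<subseteq> ?N - T" "clique C" for C
  proof -
    have "card (insert (h 0) C) \<le> w"
      using that E_sym[of "h 0"] by (intro clique_bound) (auto simp: clique_def)
    moreover have "h 0 \<notin> C" using that by auto
    moreover have "finite C" using that finN finite_subset by blast
    ultimately show ?thesis by simp
  qed
  then obtain t where t: "colourable (?N - T) t" "2 * t \<le> card (?N - T) + (w - 1)"
    using colourable_half[of "?N - T" "w - 1"] finN by auto
  have "colourable (?N - T \<union> T \<union> (A \<union> B)) (t + Suc 0 + 2)"
    by (intro colourable_Un t Tst AB)
  moreover have "V \<subseteq> ?N - T \<union> T \<union> (A \<union> B)"
    using part by (auto simp: A_def B_def)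
  ultimately have "colourable V (t + Suc 0 + 2)" by (rule colourable_subset)
  then have "colourable V (t + 3)" by (simp add: numeral_3_eq_3)
  then have "\<not> t + 3 \<le> m" using not_colourable colourable_mono by blast
  moreover have "card (?N - T) + 3 = card ?N"
    using card_Diff_subset[of T ?N] card_mono[OF finN TN] TN cardT finN finite_subset[OF TN] by auto
  moreover have "card ?N \<le> \<Delta>" using degree by simp
  moreover have "w \<ge> 1" using clique_bound[of "{h 0}"] by (simp add: clique_def)
  \<comment> \<open>Here 2(t + 3) \<le> (\<Delta> - 3) + (w - 1) + 6 = \<Delta> + w + 2 \<le> 2m +
    1, and parity absorbs the excess of one.\<close>
  ultimately show False using t(2) bound by linarith
qed

text \<open>All vertices that are not complete to the hole turn out to be adjacent to all that are,
  the partially attached ones by \<open>mixed\<close> and the anticomplete ones by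
  \<open>anti\<close>. This would be a join.\<close>

lemma no_complete_vertex:
  assumes hole: "hole n h" and d: "d \<in> V" "complete_to h d"
  shows False
proof -
  note [simp] = hole_V[OF hole]
  note hs = hole_simps[OF hole]
  have n: "5 \<le> n" "odd n" by (rule hole_length[OF hole], rule hole_odd[OF hole])
  have mixed: "E v d" if v: "v \<in> V" "E v (h i)" "\<not> E v (h j)" and d: "d \<in> V" "complete_to h d"
    for v d i j
  proof (rule ccontr)
    assume nvd: "\<not> E v d"
    obtain k where k: "E v (h k)" "E v (h (k + 1))"
      using consecutive_pair[OF hole v(1,2) d nvd] by blast
    \<comment> \<open>The hole is rotated so that \<open>v\<close> sees places 0 and 1 but not 2. A
      kite through \<open>d\<close> then forces place 3. For n = 5 this makes \<open>v\<close> a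
      flap seen from place 3; for n \<ge> 7 two more kites force places 4 and 5, three in a
      row.\<close>
    have "\<exists>k. E v (h k) \<and> E v (h (k + 1)) \<and> \<not> E v (h (k + 2))"
    proof (rule ccontr)
      assume "\<not> ?thesis"
      then have "E v (h (k + 2))" using k by blast
      then have "complete_to h v"
        using three_consecutive_complete[OF hole v(1), of "k + 1"] k by (simp add: add.commute)
      then show False using v by (simp add: complete_to_def)
    qed
    then obtain s where s: "E v (h s)" "E v (h (s + 1))" "\<not> E v (h (s + 2))" by blast
    define g where "g = (\<lambda>i. h (i + s))"
    have g: "hole n g" unfolding g_def by (rule hole_shift[OF hole])
    have dg: "E d (g i)" for i using d by (simp add: g_def complete_to_def)
    note [simp] = hole_V[OF g]
    note gs = hole_simps[OF g]
    have v012: "E v (g 0)" "E v (g 1)" "\<not> E v (g 2)"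
      using s by (simp_all add: g_def add.commute)
    have ncompl: "\<not> complete_to g v" using v012 by (auto simp: complete_to_def)
    have v3: "E v (g 3)"
      using no_kite[of d "g 2" "g 1" "g 3" v] v v012 nvd d dg n by (auto simp: gs E_commute)
    show False
    proof (cases "n = 5")
      case True
      have g5: "g 5 = g 0" "g 6 = g 1" "g 7 = g 2"
        using hole_period[OF g, of 0] hole_period[OF g, of 1] hole_period[OF g, of 2] True by auto
      have "\<not> E v (g 4)"
        using three_consecutive_complete[OF g v(1), of 4] v3 v012 g5 ncompl by auto
      then show False
        using no_flap[of "\<lambda>i. g (i + 3)" v] hole_shift[OF g, of 3] True v v012 v3 g5 by simp
    next
      case False
      then have n7: "7 \<le> n" using n by presburger
      have "E v (g 4)" "E v (g 5)"
        using no_kite[of "g 0" "g 1" d v "g 4"] no_kite[of "g 0" "g 1" d v "g 5"]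
          v v012 nvd d dg n7 by (auto simp: gs E_commute)
      then show False
        using three_consecutive_complete[OF g v(1), of 4] v3 ncompl by auto
    qed
  qed
  \<comment> \<open>For fixed \<open>d\<close>, the anticomplete vertices that miss \<open>d\<close>
    form a piece as in \<open>no_small_cut\<close>: a chair centred at \<open>d\<close> handles
    their anticomplete neighbours, \<open>mixed\<close> and a kite handle the partially attached
    ones.\<close>
  have anti: "E x d" if x: "x \<in> V" "anticomplete_to h x" and d: "d \<in> V" "complete_to h d" for x d
  proof (rule ccontr)
    assume nxd: "\<not> E x d"
    have dh: "E d (h i)" for i using d by (simp add: complete_to_def)
    show False
    proof (rule no_small_cut[OF hole, of "{x \<in> V. anticomplete_to h x \<and> \<not> E x d}"])
      fix x y assume xy: "x \<in> {x \<in> V. anticomplete_to h x \<and> \<not> E x d}" "y \<in> V" "E x y"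
      then have x: "x \<in> V" "\<not> E x d" and xh: "\<not> E x (h i)" for i
        by (auto simp: anticomplete_to_def)
      consider "anticomplete_to h y" | "complete_to h y" | i j where "E y (h i)" "\<not> E y (h j)"
        by (auto simp: anticomplete_to_def complete_to_def)
      then show "y \<in> {x \<in> V. anticomplete_to h x \<and> \<not> E x d} \<or> complete_to h y"
      proof cases
        case 1
        then have yh: "\<not> E y (h i)" for i by (simp add: anticomplete_to_def)
        have "\<not> E y d"
          using no_chair[of d "h 0" "h 2" y x] xy(2,3) x xh yh d dh n by (auto simp: hs E_commute)
        then show ?thesis using 1 xy by blast
      next
        case 3
        then obtain k where k: "E y (h k)" "\<not> E y (h (k + 1))"
          using boundary[OF hole] by blast
        have "E y d" using mixed[OF xy(2) 3 d] .
        then have False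
          using no_kite[of d "h k" y "h (k + 1)" x] xy(2,3) x xh k d dh n by (auto simp: hs E_commute)
        then show ?thesis ..
      qed auto
    qed (use x nxd in auto)
  qed
  let ?D = "{d \<in> V. complete_to h d}"
  have "\<not> E (h 0) (h 0)" by simp
  then have "h 0 \<notin> ?D" unfolding complete_to_def by blast
  then have "?D \<noteq> V" using hole_V[OF hole] by blast
  then obtain x y where "x \<in> ?D" "y \<in> V - ?D" "\<not> E x y"
    using no_join[of ?D] d by blast
  then show False
    using mixed[of y _ _ x] anti[of y x] E_sym by (auto simp: complete_to_def anticomplete_to_def)
qed

end

section \<open>Odd holes through every vertex\<close>

context chair_kite_free
begin

lemma holeI:
  assumes n: "5 \<le> n" "odd n" and V: "\<And>r. 0 \<le> r \<Longrightarrow> r < n \<Longrightarrow> H r \<in> V"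
    and adj: "\<And>r s. 0 \<le> r \<Longrightarrow> r < s \<Longrightarrow> s < n \<Longrightarrow> E (H r) (H s) \<longleftrightarrow> s = r + 1 \<or> s = r + n - 1"
  shows "hole n (\<lambda>i. H (i mod n))"
proof -
  have "E (H (i mod n)) (H (j mod n)) \<longleftrightarrow> j = i + 1 \<or> j = i + n - 1" if ij: "i < j" "j < i + n" for i j
  proof -
    define r s where "r = i mod n" and "s = j mod n"
    have rs: "0 \<le> r" "r < n" "0 \<le> s" "s < n" using n by (simp_all add: r_def s_def)
    have eq: "(s - r) mod n = j - i"
      using ij by (simp add: r_def s_def mod_diff_eq)
    consider "r < s" | "s < r" | "s = r" by linarith
    then show ?thesis
    proof cases
      case 1
      then have "s - r = j - i" using eq rs by simp
      then show ?thesis using adj[of r s] 1 rs unfolding r_def[symmetric] s_def[symmetric] by auto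
    next
      case 2
      then have "(s - r + n) mod n = s - r + n"
        using rs by (intro mod_pos_pos_trivial) auto
      then have "(s - r) mod n = s - r + n" by simp
      then show ?thesis
        using eq adj[of s r] 2 rs E_commute unfolding r_def[symmetric] s_def[symmetric] by auto
    next
      case 3
      then show ?thesis using eq ij by simp
    qed
  qed
  then show ?thesis using n V by (simp add: hole_def)
qed

end

context minimal_counterexample
begin

lemma extend_colouring:
  assumes "u \<in> V" "colours (V - {u}) m f" "i < m" "\<And>x. x \<in> V \<Longrightarrow> E u x \<Longrightarrow> f x \<noteq> i"
  shows False
proof -
  have "colours V m (f(u := i))"
    unfolding colours_def
  proof (intro conjI ballI impI)
    fix x assume "x \<in> V"
    then show "(f(u := i)) x < m" using colours_less[OF assms(2), of x] assms(3) by auto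
  next
    fix x y assume xy: "x \<in> V" "y \<in> V" "E x y"
    then show "(f(u := i)) x \<noteq> (f(u := i)) y"
      using colours_neq[OF assms(2), of x y] assms(4)[of x] assms(4)[of y] E_sym[OF xy(3)]
      by (cases "x = u"; cases "y = u") auto
  qed
  then show False using not_colourable by (auto simp: colourable_def)
qed

text \<open>Every colour occurs on the neighbourhood \<open>N\<close>, and a colour that occurs only
  once is counted a second time in \<open>R\<close>, so 2m \<le> |N| + |R|. If \<open>R\<close> were
  a clique, adding \<open>u\<close> would give |R| < w, and the sum would stay below \<Delta> +
  w.\<close>

lemma unique_colours_nonadjacent:
  assumes u: "u \<in> V" and f: "colours (V - {u}) m f"
  obtains a b where "a \<in> V" "b \<in> V" "E u a" "E u b" "a \<noteq> b" "\<not> E a b"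
    "\<And>x. x \<in> V \<Longrightarrow> E u x \<Longrightarrow> f x = f a \<Longrightarrow> x = a" "\<And>x. x \<in> V \<Longrightarrow> E u x \<Longrightarrow> f x = f b \<Longrightarrow> x = b"
proof -
  define N where "N = {x \<in> V. E u x}"
  define R where "R = {x \<in> N. \<forall>y\<in>N. f y = f x \<longrightarrow> y = x}"
  have fin: "finite N" "finite R" using finite_V by (auto simp: N_def R_def)
  have Nu: "N \<subseteq> V - {u}" by (auto simp: N_def)
  have less: "f ` N \<subseteq> {..<m}" "f ` R \<subseteq> {..<m}"
    using colours_less[OF f] Nu by (auto simp: R_def)
  have two: "2 \<le> card {x \<in> N. f x = i} + card {x \<in> R. f x = i}" if i: "i < m" for i
  proof -
    obtain x where x: "x \<in> N" "f x = i"
      using extend_colouring[OF u f i] by (auto simp: N_def)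
    show ?thesis
    proof (cases "x \<in> R")
      case True
      then have "card {x \<in> N. f x = i} \<noteq> 0" "card {x \<in> R. f x = i} \<noteq> 0"
        using x fin by auto
      then show ?thesis by linarith
    next
      case False
      then obtain y where "y \<in> N" "f y = i" "y \<noteq> x" using x by (auto simp: R_def)
      then have "card {x, y} \<le> card {x \<in> N. f x = i}"
        using x fin by (intro card_mono) auto
      then show ?thesis using \<open>y \<noteq> x\<close> by simp
    qed
  qed
  have "2 * m = (\<Sum>i<m. 2)" by simp
  also have "\<dots> \<le> (\<Sum>i<m. card {x \<in> N. f x = i} + card {x \<in> R. f x = i})"
    using two by (intro sum_mono) auto
  also have "\<dots> = (\<Sum>i<m. \<Sum>x | x \<in> N \<and> f x = i. 1) + (\<Sum>i<m. \<Sum>x | x \<in> R \<and> f x = i. 1)"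
    by (simp add: sum.distrib)
  also have "\<dots> = card N + card R"
    using sum.group[OF fin(1) finite_lessThan less(1), of "\<lambda>_. 1 :: nat"]
      sum.group[OF fin(2) finite_lessThan less(2), of "\<lambda>_. 1 :: nat"] by simp
  finally have le: "2 * m \<le> card N + card R" .
  have "\<not> clique R"
  proof
    assume "clique R"
    moreover have "E u x" "E x u" if "x \<in> R" for x
      using that E_sym[of u x] by (auto simp: R_def N_def)
    ultimately have "clique (insert u R)" unfolding clique_def by blast
    moreover have "insert u R \<subseteq> V" using u by (auto simp: R_def N_def)
    ultimately have "card (insert u R) \<le> w" by (intro clique_bound)
    moreover have "u \<notin> R" by (auto simp: R_def N_def)
    ultimately have "card R < w" using fin by simp
    moreover have "card N \<le> \<Delta>" using degree[OF u] by (simp add: N_def)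
    ultimately show False using le bound by linarith
  qed
  then obtain a b where "a \<in> R" "b \<in> R" "a \<noteq> b" "\<not> E a b" by (auto simp: clique_def)
  then show ?thesis using that[of a b] by (auto simp: R_def N_def)
qed

lemma vertex_in_hole:
  assumes u: "u \<in> V"
  obtains n h where "hole n h" "h 0 = u"
proof -
  have "V - {u} \<subset> V" using u by auto
  then obtain f where f: "colours (V - {u}) m f"
    using critical by (auto simp: colourable_def)
  obtain a b where ab: "a \<in> V" "b \<in> V" "E u a" "E u b" "a \<noteq> b" "\<not> E a b"
    and ua: "\<And>x. x \<in> V \<Longrightarrow> E u x \<Longrightarrow> f x = f a \<Longrightarrow> x = a"
    and ub: "\<And>x. x \<in> V \<Longrightarrow> E u x \<Longrightarrow> f x = f b \<Longrightarrow> x = b"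
    using unique_colours_nonadjacent[OF u f] by blast
  define i j where "i = f a" and "j = f b"
  have "a \<noteq> u" "b \<noteq> u" using ab by auto
  then have ij: "i \<noteq> j" "i < m" "j < m"
    using ub[of a] ab colours_less[OF f, of a] colours_less[OF f, of b] by (auto simp: i_def j_def)
  let ?K = "kempe (V - {u}) f i j"
  \<comment> \<open>Otherwise a swap on the chain of \<open>a\<close> recolours the only neighbour
    of \<open>u\<close> coloured \<open>i\<close> and does not touch \<open>b\<close>, the only one
    coloured \<open>j\<close>. Colour \<open>i\<close> becomes free for \<open>u\<close>.\<close>
  have "?K\<^sup>*\<^sup>* a b"
  proof (rule ccontr)
    assume nr: "\<not> ?K\<^sup>*\<^sup>* a b"
    show False
    proof (rule extend_colouring[OF u _ ij(2)])
      show "colours (V - {u}) m (kempe_swap (V - {u}) f i j a)"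
        by (rule colours_kempe_swap[OF f]) (use ij in \<open>auto simp: i_def\<close>)
      fix x assume x: "x \<in> V" "E u x"
      show "kempe_swap (V - {u}) f i j a x \<noteq> i"
      proof (cases "?K\<^sup>*\<^sup>* a x")
        case True
        then have "f x \<in> {i, j}" by (rule kempe_reach_colour) (simp add: i_def)
        moreover have "f x \<noteq> j" using True nr ub[OF x] by (auto simp: j_def)
        ultimately show ?thesis using True ij by (simp add: kempe_swap_def)
      next
        case False
        then have "f x \<noteq> i" using ua[OF x] by (auto simp: i_def)
        then show ?thesis using False by (simp add: kempe_swap_def)
      qed
    qed
  qed
  then obtain p l where p: "p 0 = a" "p l = b" and step: "\<And>k. k < l \<Longrightarrow> ?K (p k) (p (Suc k))"
    and short: "\<And>k k'. k \<le> l \<Longrightarrow> k' \<le> l \<Longrightarrow> ?K (p k) (p k') \<Longrightarrow> k = Suc k' \<or> k' = Suc k \<or> k = k'"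
    and inj: "inj_on p {..l}"
    by (rule shortest_path) (auto intro: kempe_sym)
  have "0 < l" using p ab by (cases l) auto
  have pk: "p k \<in> V - {u}" "f (p k) \<in> {i, j}" if "k \<le> l" for k
    using step[of k] step[of "k - 1"] that \<open>0 < l\<close> by (cases "k = l"; auto simp: kempe_def)+
  have alt: "f (p k) = (if even k then i else j)" if "k \<le> l" for k
    using that
  proof (induction k)
    case 0
    then show ?case using p by (simp add: i_def)
  next
    case (Suc k)
    then have "f (p (Suc k)) \<noteq> f (p k)"
      using step[of k] colours_neq[OF f, of "p k" "p (Suc k)"] by (auto simp: kempe_def)
    then show ?case using Suc pk(2)[of "Suc k"] by auto
  qed
  have "f (p l) = j" by (simp add: p j_def)
  then have odd: "odd l" using alt[of l] ij(1) by (cases "even l") simp_all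
  have padj: "E (p k) (p k') \<longleftrightarrow> k' = Suc k" if "k < k'" "k' \<le> l" for k k'
  proof
    assume "E (p k) (p k')"
    then have "?K (p k) (p k')" using pk[of k] pk[of k'] that by (simp add: kempe_def)
    then show "k' = Suc k" using short[of k k'] that by auto
  next
    assume "k' = Suc k"
    then show "E (p k) (p k')" using step[of k] that by (simp add: kempe_def)
  qed
  have uadj: "E u (p k) \<longleftrightarrow> k = 0 \<or> k = l" if "k \<le> l" for k
  proof
    assume e: "E u (p k)"
    have "p k = a \<or> p k = b"
      using pk[OF that] ua[OF _ e] ub[OF _ e] by (auto simp: i_def j_def)
    then show "k = 0 \<or> k = l" using p inj_onD[OF inj, of k 0] inj_onD[OF inj, of k l] that by auto
  next
    assume "k = 0 \<or> k = l"
    then show "E u (p k)" using p ab by auto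
  qed
  have "l \<noteq> 1" using padj[of 0 1] p ab by auto
  then have "3 \<le> l" using odd \<open>0 < l\<close> by presburger
  \<comment> \<open>With \<open>u\<close> at place 0 and the l + 1 path vertices after it, the
    length is l + 2. It is odd since the colours alternate and differ at the ends; it is at least 5
    since l = 1 would make \<open>a\<close> and \<open>b\<close> adjacent.\<close>
  define H where "H r = (if r = 0 then u else p (nat (r - 1)))" for r :: int
  have "hole (int l + 2) (\<lambda>i. H (i mod (int l + 2)))"
  proof (rule holeI)
    show "5 \<le> int l + 2" "odd (int l + 2)" using \<open>3 \<le> l\<close> odd by auto
    show "H r \<in> V" if "0 \<le> r" "r < int l + 2" for r
      using that u pk(1)[of "nat (r - 1)"] by (auto simp: H_def)
    show "E (H r) (H s) \<longleftrightarrow> s = r + 1 \<or> s = r + (int l + 2) - 1"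
      if "0 \<le> r" "r < s" "s < int l + 2" for r s
    proof (cases "r = 0")
      case True
      then show ?thesis using that uadj[of "nat (s - 1)"] by (auto simp: H_def)
    next
      case False
      then show ?thesis
        using that padj[of "nat (r - 1)" "nat (s - 1)"] by (auto simp: H_def)
    qed
  qed
  moreover have "H (0 mod (int l + 2)) = u" by (simp add: H_def)
  ultimately show ?thesis using that by blast
qed

section \<open>The neighbourhood of a vertex on an odd hole\<close>

context
  fixes n h assumes hole: "hole n h"
begin

text \<open>The vertex under study is \<open>h 0\<close>, and mirrored versions come from
  \<open>hole_reflect\<close>. A third consecutive neighbour would make \<open>c\<close> complete to
  the hole.\<close>

lemma side_exclusive:
  assumes "c \<in> V" "E c (h 0)" "E c (h 1)"
  shows "\<not> E c (h (-1))"
proof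
  assume "E c (h (-1))"
  then have "complete_to h c"
    using three_consecutive_complete[OF hole assms(1), of 0] assms by simp
  then show False by (rule no_complete_vertex[OF hole assms(1)])
qed

lemma side_next:
  assumes "c \<in> V" "E c (h 0)" "E c (h 1)"
  shows "\<not> E c (h 2)"
proof
  assume "E c (h 2)"
  then show False
    using no_kite[of "h 1" c "h 0" "h 2" "h (-1)"] assms side_exclusive[OF assms]
      hole_length[OF hole] hole_V[OF hole] by (auto simp: hole_simps[OF hole] E_commute)
qed

lemma long_if_not_5: "n \<noteq> 5 \<Longrightarrow> 7 \<le> n"
  using hole_length[OF hole] hole_odd[OF hole] by presburger

lemma period5:
  assumes "n = 5"
  shows "h (-1) = h 4" "h (-2) = h 3" "h 5 = h 0" "h 6 = h 1" "h 7 = h 2"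
proof -
  have "h (i + 5) = h i" for i using hole_period[OF hole, of i] assms by simp
  from this[of "-1"] this[of "-2"] this[of 0] this[of 1] this[of 2]
  show "h (-1) = h 4" "h (-2) = h 3" "h 5 = h 0" "h 6 = h 1" "h 7 = h 2" by simp_all
qed

text \<open>If \<open>c\<close> saw neither, chairs centred at \<open>h 0\<close> would force it to
  see \<open>h 2\<close> and \<open>h (-2)\<close>. On a 5-hole this is a flap. On a longer hole a
  chair centred at \<open>h 2\<close> forces \<open>h 3\<close>, and then \<open>c\<close> is itself
  the centre of a chair.\<close>

lemma side_exists:
  assumes c: "c \<in> V" "E c (h 0)" "c \<noteq> h 1" "c \<noteq> h (-1)"
  shows "E c (h 1) \<or> E c (h (-1))"
proof (rule ccontr)
  assume "\<not> ?thesis"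
  then have nc: "\<not> E c (h 1)" "\<not> E c (h (-1))" by auto
  note hs = hole_simps[OF hole] E_commute
  note facts = c nc hole_length[OF hole] hole_V[OF hole]
  have c2: "E c (h 2)"
    using no_chair[of "h 0" "h (-1)" c "h 1" "h 2"] facts by (auto simp: hs)
  have c_2: "E c (h (-2))"
    using no_chair[of "h 0" "h 1" c "h (-1)" "h (-2)"] facts by (auto simp: hs)
  show False
  proof (cases "n = 5")
    case True
    then show False using no_flap[of h c] hole c nc c2 c_2 period5 by simp
  next
    case False
    note n7 = long_if_not_5[OF False]
    have "E c (h 3)"
      using no_chair[of "h 2" "h 1" "h 3" c "h (-2)"] facts n7 c2 c_2 by (auto simp: hs)
    then show False
      using no_chair[of c "h 3" "h (-2)" "h 0" "h 1"] facts n7 c2 c_2 by (auto simp: hs)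
  qed
qed

text \<open>On a long hole, a vertex attached to the edge from \<open>h 0\<close> to
  \<open>h 1\<close> may have further neighbours. If \<open>h (-2)\<close> is one, the attachment
  there is again exactly an edge, and the two empty places behind it provide long legs for
  chairs.\<close>

lemma second_edge:
  assumes c: "c \<in> V" "E c (h 0)" "E c (h 1)" "E c (h (-2))"
  shows "7 \<le> n" "E c (h (-3))" "\<not> E c (h (-4))" "\<not> E c (h (-5))"
proof -
  note hs = hole_simps[OF hole] E_commute
  have nc: "\<not> E c (h (-1))" "\<not> E c (h 2)"
    using side_exclusive side_next c by auto
  note facts = c nc hole_V[OF hole]
  have "n \<noteq> 5"
    using no_flap[of "\<lambda>i. h (i + 3)" c] hole_shift[OF hole, of 3] c nc period5 by auto
  then show n7: "7 \<le> n" by (rule long_if_not_5)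
  show c3: "E c (h (-3))"
    using no_chair[of "h (-2)" "h (-1)" "h (-3)" c "h 1"] facts n7 by (auto simp: hs)
  show "\<not> E c (h (-4))"
    using three_consecutive_complete[OF hole c(1), of "-3"] no_complete_vertex[OF hole c(1)] c c3
    by auto
  \<comment> \<open>For n = 7 the place -5 is the place 2; from n = 9 on, \<open>h 1\<close> and
    \<open>h (-5)\<close> are nonadjacent and can be leaves of one chair.\<close>
  show "\<not> E c (h (-5))"
  proof (cases "n = 7")
    case True
    then show ?thesis using hole_period[OF hole, of "-5"] nc by simp
  next
    case False
    then have "9 \<le> n" using n7 hole_odd[OF hole] by presburger
    then show ?thesis
      using no_chair[of c "h 1" "h (-5)" "h (-2)" "h (-1)"] facts by (auto simp: hs)
  qed
qed

text \<open>If \<open>c\<close> and \<open>d\<close> were nonadjacent, a chair at \<open>h 0\<close>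
  makes one of them see \<open>h (-2)\<close>, and kites on the edge from \<open>h 0\<close> to
  \<open>h 1\<close> make both do so. By \<open>second_edge\<close> they are then leaves of a chair
  centred at \<open>h (-3)\<close> with long leg \<open>h (-4)\<close>,
  \<open>h (-5)\<close>.\<close>

lemma side_clique:
  assumes c: "c \<in> V" "E c (h 0)" "E c (h 1)" and d: "d \<in> V" "E d (h 0)" "E d (h 1)" and "c \<noteq> d"
  shows "E c d"
proof (rule ccontr)
  assume ncd: "\<not> E c d"
  note hs = hole_simps[OF hole] E_commute
  note facts = c d ncd \<open>c \<noteq> d\<close> hole_V[OF hole] side_exclusive[OF c] side_exclusive[OF d]
    hole_length[OF hole]
  have "E c (h (-2)) \<or> E d (h (-2))"
    using no_chair[of "h 0" c d "h (-1)" "h (-2)"] facts by (auto simp: hs)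
  moreover have "E c (h (-2)) \<longleftrightarrow> E d (h (-2))"
    using no_kite[of "h 0" "h 1" c d "h (-2)"] no_kite[of "h 0" "h 1" d c "h (-2)"] facts
    by (auto simp: hs)
  ultimately have c2: "E c (h (-2))" and d2: "E d (h (-2))" by auto
  show False
    using no_chair[of "h (-3)" c d "h (-4)" "h (-5)"] facts second_edge[OF c c2] second_edge[OF d d2]
    by (auto simp: hs)
qed

end

text \<open>If adjacent, each would see, by a kite, the vertex two steps away on the other's far
  side. Then \<open>second_edge\<close> gives \<open>E d (h 3)\<close>, and \<open>c\<close> is the
  centre of a chair with leaves \<open>h 1\<close>, \<open>h (-2)\<close> and long leg
  \<open>d\<close>, \<open>h 3\<close>.\<close>

lemma sides_anticomplete:
  assumes hole: "hole n h"
    and c: "c \<in> V" "E c (h 0)" "E c (h 1)" and d: "d \<in> V" "E d (h 0)" "E d (h (-1))"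
  shows "\<not> E c d"
proof
  assume cd: "E c d"
  note hs = hole_simps[OF hole] E_commute
  have rh: "hole n (\<lambda>i. h (- i))" by (rule hole_reflect[OF hole])
  have nc: "\<not> E c (h (-1))" "\<not> E c (h 2)"
    using side_exclusive[OF hole c] side_next[OF hole c] by auto
  have nd: "\<not> E d (h 1)" "\<not> E d (h (-2))"
    using side_exclusive[OF rh, of d] side_next[OF rh, of d] d by auto
  note facts = c d cd nc nd hole_V[OF hole] hole_length[OF hole]
  have d2: "E d (h 2)"
    using no_kite[of "h 0" c "h 1" d "h 2"] facts by (auto simp: hs)
  have c2: "E c (h (-2))"
    using no_kite[of "h 0" d "h (-1)" c "h (-2)"] facts by (auto simp: hs)
  have n7: "7 \<le> n" using second_edge(1)[OF hole c c2] .
  have d3: "E d (h 3)" using second_edge(2)[OF rh, of d] d d2 by simp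
  have c3: "\<not> E c (h 3)"
    using no_chair[of c "h 1" "h 3" "h (-2)" "h (-1)"] facts c2 n7 by (auto simp: hs)
  show False
    using no_chair[of c "h 1" "h (-2)" d "h 3"] facts c2 d3 c3 n7 by (auto simp: hs)
qed

text \<open>Any odd hole through \<open>u\<close> shows the partition: its two neighbours of
  \<open>u\<close> represent the two cliques.\<close>

lemma neighbourhood_two_cliques:
  assumes u: "u \<in> V"
  shows "\<exists>A B. {x \<in> V. E u x} = A \<union> B \<and> A \<inter> B = {} \<and> clique A \<and> clique B \<and>
    (\<forall>x\<in>A. \<forall>y\<in>B. \<not> E x y)"
proof -
  obtain n h where hole: "hole n h" and h0: "h 0 = u" by (rule vertex_in_hole[OF u])
  have rh: "hole n (\<lambda>i. h (- i))" by (rule hole_reflect[OF hole])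
  note hs = hole_simps[OF hole]
  have n: "5 \<le> n" by (rule hole_length[OF hole])
  define A where "A = {x \<in> V. E u x \<and> (x = h 1 \<or> E x (h 1))}"
  define B where "B = {x \<in> V. E u x \<and> (x = h (-1) \<or> E x (h (-1)))}"
  have "{x \<in> V. E u x} = A \<union> B"
    using side_exists[OF hole] h0 E_sym[of u] by (auto simp: A_def B_def)
  moreover have excl: "\<not> E x (h (-1))" "x \<noteq> h (-1)" if "x \<in> A" for x
    using that side_exclusive[OF hole, of x] h0 E_sym[of u] n by (auto simp: A_def hs)
  then have "A \<inter> B = {}" by (auto simp: B_def)
  moreover have "clique A"
    unfolding clique_def
  proof (intro ballI impI)
    fix x y assume "x \<in> A" "y \<in> A" "x \<noteq> y"
    then show "E x y"
      using side_clique[OF hole, of x y] h0 E_sym[of u x] E_sym[of u y] E_sym[of y "h 1"]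
      by (auto simp: A_def)
  qed
  moreover have "clique B"
    unfolding clique_def
  proof (intro ballI impI)
    fix x y assume "x \<in> B" "y \<in> B" "x \<noteq> y"
    then show "E x y"
      using side_clique[OF rh, of x y] h0 E_sym[of u x] E_sym[of u y] E_sym[of y "h (-1)"]
      by (auto simp: B_def)
  qed
  moreover have "\<not> E x y" if x: "x \<in> A" and y: "y \<in> B" for x y
  proof -
    have "\<not> E y (h 1)" if "E y (h (-1))"
      using side_exclusive[OF rh, of y] that y h0 E_sym[of u y] by (auto simp: B_def)
    then show ?thesis
      using sides_anticomplete[OF hole, of x y] x y excl[OF x] h0 E_sym[of u x] E_sym[of u y] E_sym[of x y]
      by (auto simp: A_def B_def)
  qed
  then have "\<forall>x\<in>A. \<forall>y\<in>B. \<not> E x y" by simp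
  ultimately show ?thesis by (intro exI[of _ A] exI[of _ B] conjI)
qed

end

section \<open>Edge colouring\<close>

text \<open>By now \<open>G\<close> is the line graph of a triangle-free graph \<open>H\<close>. Let the uncoloured vertex \<open>u\<close> be
  the edge \<open>xy\<close> of \<open>H\<close> and let \<open>e = xy'\<close> have a colour missing at \<open>y\<close>. Then the sets of colours
  missing at \<open>x\<close>, \<open>y\<close> and \<open>y'\<close> are disjoint, as in the proof of Vizing's theorem. The sets \<open>X\<close>, \<open>Y\<close>
  and \<open>Y'\<close> below are the edges at \<open>x\<close> except \<open>u\<close>, at \<open>y\<close> except \<open>u\<close>, and at \<open>y'\<close> except \<open>e\<close>.\<close>

context minimal_counterexample
begin

text \<open>The chain neighbours of \<open>v\<close> all have the same colour, and each of the two
  cliques around \<open>v\<close> holds at most one vertex of that colour. Kempe chains are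
  therefore paths or cycles.\<close>

lemma two_colour_degree:
  assumes f: "colours (V - {u}) m f" and v: "v \<in> V"
    and abc: "kempe (V - {u}) f i j v a" "kempe (V - {u}) f i j v b" "kempe (V - {u}) f i j v c"
  shows "a = b \<or> a = c \<or> b = c"
proof -
  obtain A B where AB: "{x \<in> V. E v x} = A \<union> B" "clique A" "clique B"
    using neighbourhood_two_cliques[OF v] by blast
  have colour: "f a = f b" "f a = f c"
    using abc colours_neq[OF f, of v a] colours_neq[OF f, of v b] colours_neq[OF f, of v c]
    by (auto simp: kempe_def)
  have mem: "a \<in> A \<union> B" "b \<in> A \<union> B" "c \<in> A \<union> B" "a \<in> V - {u}" "b \<in> V - {u}" "c \<in> V - {u}"
    using abc AB(1) by (auto simp: kempe_def)
  have "x = y" if "x \<in> A \<and> y \<in> A \<or> x \<in> B \<and> y \<in> B" "f x = f y" "x \<in> V - {u}" "y \<in> V - {u}" for x y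
    using that AB(2,3) colours_neq[OF f, of x y] by (auto simp: clique_def)
  then show ?thesis using mem colour by (metis Un_iff)
qed

text \<open>The vertex \<open>g\<close> marks one of the two cliques around \<open>v\<close>. If the
  chain does not continue there, it can continue only in the other clique, where the colour occurs
  at most once.\<close>

lemma end_of_chain:
  assumes f: "colours (V - {u}) m f" and v: "v \<in> V" and g: "g \<in> V" "E v g"
    and no: "\<And>x. kempe (V - {u}) f i j v x \<Longrightarrow> \<not> E g x \<and> x \<noteq> g"
    and ab: "kempe (V - {u}) f i j v a" "kempe (V - {u}) f i j v b"
  shows "a = b"
proof (rule ccontr)
  assume "a \<noteq> b"
  obtain A B where AB: "{x \<in> V. E v x} = A \<union> B" "clique A" "clique B"
    using neighbourhood_two_cliques[OF v] by blast
  have colour: "f a = f b"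
    using ab colours_neq[OF f, of v a] colours_neq[OF f, of v b] by (auto simp: kempe_def)
  have V: "a \<in> V - {u}" "b \<in> V - {u}" "a \<in> A \<union> B" "b \<in> A \<union> B" "g \<in> A \<union> B"
    using ab AB(1) g by (auto simp: kempe_def)
  have "\<not> E a b" using colours_neq[OF f V(1,2)] colour by blast
  moreover have "\<not> E g a" "g \<noteq> a" "\<not> E g b" "g \<noteq> b" using no ab by auto
  ultimately show False
    using V(3-5) AB(2,3) \<open>a \<noteq> b\<close> unfolding clique_def by (metis Un_iff)
qed

lemma impossible: False
proof -
  \<comment> \<open>Every colour occurs around an uncoloured vertex, so m \<le> \<Delta>, and the
    bound leaves w + 1 \<le> m. Hence some colour is missing at each end of
    \<open>u\<close>.\<close>
  have wm: "w + 1 \<le> m" and Vne: "V \<noteq> {}"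
  proof -
    show "V \<noteq> {}" using not_colourable by (auto simp: colourable_def colours_def)
    then obtain u where u: "u \<in> V" by blast
    then have "V - {u} \<subset> V" by auto
    then obtain f where f: "colours (V - {u}) m f" using critical by (auto simp: colourable_def)
    have "{..<m} \<subseteq> f ` {x \<in> V. E u x}"
      using extend_colouring[OF u f] by blast
    then have "m \<le> card {x \<in> V. E u x}"
      using finite_V surj_card_le[of "{x \<in> V. E u x}" "{..<m}" f] by simp
    then show "w + 1 \<le> m" using degree[OF u] bound by linarith
  qed
  then obtain u where u: "u \<in> V" by blast
  then have "V - {u} \<subset> V" by auto
  then obtain f where f: "colours (V - {u}) m f" using critical by (auto simp: colourable_def)
  obtain X Y where N: "{x \<in> V. E u x} = X \<union> Y" and XYd: "X \<inter> Y = {}"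
    and cl: "clique X" "clique Y" and XY: "\<And>x y. x \<in> X \<Longrightarrow> y \<in> Y \<Longrightarrow> \<not> E x y"
    using neighbourhood_two_cliques[OF u] by blast
  have NX: "x \<in> V" "E u x" "x \<noteq> u" "E x u" if "x \<in> X \<or> x \<in> Y" for x
  proof -
    have "x \<in> {x \<in> V. E u x}" unfolding N using that by blast
    then show "x \<in> V" "E u x" "x \<noteq> u" "E x u" using E_sym[of u x] by auto
  qed
  have NXY: "x \<in> X \<or> x \<in> Y" if "x \<in> V" "E u x" for x using that N by blast
  have fin: "finite X" "finite Y" using finite_V NX finite_subset[of _ V] by blast+
  have small: "card S < m" if "clique S" "S \<subseteq> V" "v \<in> V" "\<And>x. x \<in> S \<Longrightarrow> E v x" for S v
  proof -
    have "clique (insert v S)" using that E_sym unfolding clique_def by blast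
    then have "card (insert v S) \<le> w" using that by (intro clique_bound) auto
    moreover have "v \<notin> S" using that by force
    moreover have "finite S" using that(2) finite_V finite_subset by blast
    ultimately show ?thesis using wm by simp
  qed
  have missing: "\<exists>i<m. i \<notin> f ` S" if "card S < m" "finite S" for S
  proof -
    have "card (f ` S) < m" using that card_image_le[of S f] by linarith
    then have "\<not> {..<m} \<subseteq> f ` S"
      using card_mono[of "f ` S" "{..<m}"] that(2) by auto
    then show ?thesis by auto
  qed
  have "card Y < m" "card X < m" using small[of Y u] small[of X u] cl NX u by blast+
  then obtain c \<alpha> where c: "c < m" "c \<notin> f ` Y" and \<alpha>: "\<alpha> < m" "\<alpha> \<notin> f ` X"
    using missing fin by metis
  then obtain e where e: "e \<in> X" "f e = c"
    using extend_colouring[OF u f c(1)] NXY by blast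
  have eV: "e \<in> V" "e \<noteq> u" "E u e" "E e u" using NX[of e] e by auto
  obtain Z Y' where Ne: "{x \<in> V. E e x} = Z \<union> Y'" and ZY'd: "Z \<inter> Y' = {}"
    and cle: "clique Z" "clique Y'" and ZY': "\<And>x y. x \<in> Z \<Longrightarrow> y \<in> Y' \<Longrightarrow> \<not> E x y" and uZ: "u \<in> Z"
  proof -
    obtain P Q where PQ: "{x \<in> V. E e x} = P \<union> Q" "P \<inter> Q = {}" "clique P" "clique Q"
      "\<And>x y. x \<in> P \<Longrightarrow> y \<in> Q \<Longrightarrow> \<not> E x y"
      using neighbourhood_two_cliques[OF eV(1)] by blast
    have "u \<in> P \<or> u \<in> Q" using PQ(1) u eV by blast
    then show ?thesis
    proof
      assume "u \<in> P"
      then show ?thesis using that[of P Q] PQ by blast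
    next
      assume "u \<in> Q"
      moreover have "\<not> E x y" if "x \<in> Q" "y \<in> P" for x y using PQ(5)[OF that(2,1)] E_sym by blast
      ultimately show ?thesis using that[of Q P] PQ(1-4) by blast
    qed
  qed
  have NZ: "x \<in> V" "E e x" "x \<noteq> e" if "x \<in> Z \<or> x \<in> Y'" for x
  proof -
    have "x \<in> {x \<in> V. E e x}" unfolding Ne using that by blast
    then show "x \<in> V" "E e x" "x \<noteq> e" by auto
  qed
  \<comment> \<open>In \<open>H\<close>, the edges \<open>u\<close> and \<open>e\<close> share the
    end x, so both \<open>X\<close> and \<open>Z\<close> are the star at x, with \<open>u\<close> or
    \<open>e\<close> left out respectively.\<close>
  have Z: "Z = insert u (X - {e})"
  proof
    show "Z \<subseteq> insert u (X - {e})"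
    proof
      fix x assume x: "x \<in> Z"
      have xe: "x \<in> V" "E e x" "x \<noteq> e" using NZ x by auto
      show "x \<in> insert u (X - {e})"
      proof (cases "x = u")
        case False
        then have "E u x" using cle(1) x uZ by (auto simp: clique_def)
        then have "x \<in> X" using NXY[OF xe(1)] XY[OF e(1)] xe by blast
        then show ?thesis using xe by blast
      qed simp
    qed
    show "insert u (X - {e}) \<subseteq> Z"
    proof -
      have "x \<in> Z" if x: "x \<in> X" "x \<noteq> e" for x
      proof -
        have "E e x" using cl(1) e x by (auto simp: clique_def)
        then have "x \<in> Z \<or> x \<in> Y'" using Ne NX(1)[of x] x by blast
        then show ?thesis using ZY'[OF uZ] NX(2)[of x] x by blast
      qed
      then show ?thesis using uZ by auto
    qed
  qed
  have NY': "x \<in> V" "E e x" "x \<noteq> u" "x \<notin> X" "\<not> E u x" if "x \<in> Y'" for x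
    using that NZ[of x] ZY'd uZ ZY'[OF uZ that] Z by auto
  have Ne': "x = u \<or> x \<in> X \<or> x \<in> Y'" if "x \<in> V" "E e x" for x
    using that Ne Z by blast
  have finY': "finite Y'" using finite_V NY'(1) finite_subset[of _ V] by blast
  have XY': "\<not> E x y" if "x \<in> X" "y \<in> Y'" "x \<noteq> e" for x y
    using ZY'[of x y] that Z by blast
  \<comment> \<open>A colour missing at both x and y' could be given to \<open>e\<close>. This frees
    \<open>c\<close> at x, and \<open>c\<close> is missing at y, so \<open>u\<close> could be
    coloured. The colouring \<open>g\<close> is arbitrary because the argument is needed again after
    a Kempe swap.\<close>
  have recolour_e: False
    if g: "colours (V - {u}) m g" and gc: "g e = c" "c \<notin> g ` Y"
      and i: "i < m" "i \<notin> g ` X" "i \<notin> g ` Y'" for g i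
  proof (rule extend_colouring[OF u _ c(1)])
    have "i \<noteq> c" using i gc e by auto
    show "colours (V - {u}) m (g(e := i))"
      unfolding colours_def
    proof (intro conjI ballI impI)
      fix x assume "x \<in> V - {u}"
      then show "(g(e := i)) x < m" using colours_less[OF g, of x] i by auto
    next
      fix x y assume xy: "x \<in> V - {u}" "y \<in> V - {u}" "E x y"
      have ee: "g z \<noteq> i" if "z \<in> V - {u}" "E e z" for z
        using Ne'[of z] that i by auto
      show "(g(e := i)) x \<noteq> (g(e := i)) y"
        using colours_neq[OF g xy] ee[of x] ee[of y] xy E_sym[OF xy(3)]
        by (cases "x = e"; cases "y = e") auto
    qed
    fix x assume x: "x \<in> V" "E u x"
    show "(g(e := i)) x \<noteq> c"
    proof (cases "x = e")
      case False
      have "g x \<noteq> c"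
      proof (cases "x \<in> X")
        case True
        then have "E x e" using cl(1) e False by (auto simp: clique_def)
        then show ?thesis using colours_neq[OF g, of x e] gc NX[of x] True eV by auto
      next
        case False
        then have "x \<in> Y" using NXY[OF x] by blast
        then show ?thesis using gc(2) by blast
      qed
      then show ?thesis using False by simp
    qed (use \<open>i \<noteq> c\<close> in simp)
  qed
  have noXY: "i \<in> f ` X \<or> i \<in> f ` Y" if "i < m" for i
    using extend_colouring[OF u f that] NXY by blast
  have noXY': "i \<in> f ` X \<or> i \<in> f ` Y'" if "i < m" for i
    using recolour_e[OF f e(2) c(2) that] by blast
  \<comment> \<open>The exception for \<open>c\<close> is due to \<open>e\<close>, which has this
    colour at y' but is left out of \<open>Y'\<close>. A further colour \<beta> missing at y and y'
    would make \<open>b\<close>, \<open>y\<close> and \<open>z\<close> three ends of one chain in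
    \<alpha> and \<beta>.\<close>
  have noYY': "\<beta> \<in> f ` Y \<or> \<beta> \<in> f ` Y' \<or> \<beta> = c" if \<beta>: "\<beta> < m" for \<beta>
  proof (rule ccontr)
    assume "\<not> ?thesis"
    then have n\<beta>: "\<beta> \<notin> f ` Y" "\<beta> \<notin> f ` Y'" "\<beta> \<noteq> c" by auto
    obtain b where b: "b \<in> X" "f b = \<beta>" using noXY[OF \<beta>] n\<beta>(1) by blast
    obtain y where y: "y \<in> Y" "f y = \<alpha>" using noXY[OF \<alpha>(1)] \<alpha>(2) by blast
    obtain z where z: "z \<in> Y'" "f z = \<alpha>" using noXY'[OF \<alpha>(1)] \<alpha>(2) by blast
    have ab: "\<alpha> \<noteq> \<beta>" "\<alpha> \<noteq> c" using \<alpha>(2) b e by blast+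
    let ?K = "kempe (V - {u}) f \<alpha> \<beta>"
    have uniq: "x = x'" if "x \<in> S" "x' \<in> S" "f x = f x'" "clique S" "S \<subseteq> V - {u}" for x x' S
      using inj_on_colours_clique[OF that(4) colours_subset[OF f that(5)]] that(1-3)
      by (auto simp: inj_on_def)
    have sub: "X \<subseteq> V - {u}" "Y \<subseteq> V - {u}" "Y' \<subseteq> V - {u}"
      using NX(1,3) NY'(1,3) by blast+
    have inV: "b \<in> V" "y \<in> V" "z \<in> V" using NX(1) b(1) y(1) NY'(1) z(1) by blast+
    have swapX: "\<alpha> \<notin> kempe_swap (V - {u}) f \<alpha> \<beta> v ` X"
      if "f v = \<alpha>" "\<not> ?K\<^sup>*\<^sup>* v b" for v
    proof
      assume "\<alpha> \<in> kempe_swap (V - {u}) f \<alpha> \<beta> v ` X"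
      then obtain x where x: "x \<in> X" "kempe_swap (V - {u}) f \<alpha> \<beta> v x = \<alpha>" by auto
      have "f x \<noteq> \<alpha>" using x(1) \<alpha>(2) by blast
      then have "?K\<^sup>*\<^sup>* v x" using x(2) by (auto simp: kempe_swap_def split: if_splits)
      moreover from this have "f x \<in> {\<alpha>, \<beta>}" by (rule kempe_reach_colour) (simp add: that)
      then have "x = b" using \<open>f x \<noteq> \<alpha>\<close> uniq[OF x(1) b(1) _ cl(1) sub(1)] b(2) by simp
      ultimately show False using that by blast
    qed
    have swapS: "\<alpha> \<notin> kempe_swap (V - {u}) f \<alpha> \<beta> v ` S"
      if v: "v \<in> S" "f v = \<alpha>" and S: "clique S" "S \<subseteq> V - {u}" "\<beta> \<notin> f ` S" for v S
    proof
      assume "\<alpha> \<in> kempe_swap (V - {u}) f \<alpha> \<beta> v ` S"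
      then obtain x where x: "x \<in> S" "kempe_swap (V - {u}) f \<alpha> \<beta> v x = \<alpha>" by auto
      show False
      proof (cases "f x = \<alpha>")
        case True
        then have "x = v" using uniq[OF x(1) v(1) _ S(1,2)] v(2) by simp
        then show False using x(2) True ab(1) by (simp add: kempe_swap_def)
      next
        case False
        moreover have "f x \<noteq> \<beta>" using x(1) S(3) by blast
        ultimately show False using x(2) kempe_swap_other[of f x \<alpha> \<beta> v "V - {u}"] v(2) by simp
      qed
    qed
    have swap_other: "kempe_swap (V - {u}) f \<alpha> \<beta> v x = c \<longleftrightarrow> f x = c" if "f v = \<alpha>" for v x
      using kempe_swap_other[of f x \<alpha> \<beta> v "V - {u}"] kempe_reach_colour[of "V - {u}" f \<alpha> \<beta> v x]
        that ab n\<beta>(3) by (auto simp: kempe_swap_def)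
    have swap_col: "colours (V - {u}) m (kempe_swap (V - {u}) f \<alpha> \<beta> v)" if "f v = \<alpha>" for v
      by (rule colours_kempe_swap[OF f \<alpha>(1) \<beta> ab(1)]) (simp add: that)
    \<comment> \<open>Only \<open>b\<close> could bring \<alpha> to x in a swap. If the chain of
      \<open>y\<close> missed \<open>b\<close>, swapping it would leave \<alpha> missing at x and y
      and available for \<open>u\<close>. For \<open>z\<close> in place of \<open>y\<close>, it
      would be missing at x and y' and available for \<open>e\<close>.\<close>
    have "?K\<^sup>*\<^sup>* y b"
    proof (rule ccontr)
      assume "\<not> ?K\<^sup>*\<^sup>* y b"
      then have "\<alpha> \<notin> kempe_swap (V - {u}) f \<alpha> \<beta> y ` X" "\<alpha> \<notin> kempe_swap (V - {u}) f \<alpha> \<beta> y ` Y"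
        using swapX[OF y(2)] swapS[OF y cl(2) sub(2) n\<beta>(1)] by auto
      then have "kempe_swap (V - {u}) f \<alpha> \<beta> y x \<noteq> \<alpha>" if "x \<in> V" "E u x" for x
        using NXY[OF that] by (metis image_eqI)
      then show False by (rule extend_colouring[OF u swap_col[OF y(2)] \<alpha>(1)])
    qed
    moreover have "?K\<^sup>*\<^sup>* z b"
    proof (rule ccontr)
      assume "\<not> ?K\<^sup>*\<^sup>* z b"
      then have "\<alpha> \<notin> kempe_swap (V - {u}) f \<alpha> \<beta> z ` X" "\<alpha> \<notin> kempe_swap (V - {u}) f \<alpha> \<beta> z ` Y'"
        using swapX[OF z(2)] swapS[OF z cle(2) sub(3) n\<beta>(2)] by auto
      moreover have "kempe_swap (V - {u}) f \<alpha> \<beta> z e = c"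
        using swap_other[OF z(2)] e(2) by blast
      moreover have "c \<notin> kempe_swap (V - {u}) f \<alpha> \<beta> z ` Y"
      proof
        assume "c \<in> kempe_swap (V - {u}) f \<alpha> \<beta> z ` Y"
        then obtain x where "x \<in> Y" "kempe_swap (V - {u}) f \<alpha> \<beta> z x = c" by auto
        then have "x \<in> Y" "f x = c" using swap_other[OF z(2), of x] by simp_all
        then show False using c(2) by blast
      qed
      ultimately show False using recolour_e[OF swap_col[OF z(2)] _ _ \<alpha>(1)] by simp
    qed
    moreover have "symp ?K" by (rule sympI) (rule kempe_sym)
    then have "symp ?K\<^sup>*\<^sup>*" by (rule symp_rtranclp)
    ultimately have reach: "?K\<^sup>*\<^sup>* b y" "?K\<^sup>*\<^sup>* b z" by (blast dest: sympD)+
    show False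
    proof (rule three_ends_impossible[of ?K b y z])
      show "?K y x" if "?K x y" for x y using that by (rule kempe_sym)
      show "s = t \<or> s = r \<or> t = r" if "?K x s" "?K x t" "?K x r" for x s t r
        using two_colour_degree[OF f _ that] that by (auto simp: kempe_def)
      show "b \<noteq> y" "b \<noteq> z" using ab b y z by auto
      show "y \<noteq> z" using NY'(5)[OF z(1)] NX(2)[of y] y by auto
      show "?K\<^sup>*\<^sup>* b y" "?K\<^sup>*\<^sup>* b z" by (fact reach)+
      fix x s t assume x: "x \<in> {b, y, z}" and st: "?K x s" "?K x t"
      have other: "f s = (if f x = \<alpha> then \<beta> else \<alpha>)" "s \<in> V" "s \<noteq> u" "E x s" if "?K x s" for x s
        using that colours_neq[OF f, of x s] by (auto simp: kempe_def)
      have bs: "\<not> E u s \<and> s \<noteq> u" if "?K b s" for s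
      proof -
        have s: "f s = \<alpha>" "s \<in> V" "s \<noteq> u" "E b s" using other[OF that] b ab by auto
        then have "s \<notin> X" "s \<notin> Y" using \<alpha>(2) XY[OF b(1), of s] by blast+
        then show ?thesis using NXY s by blast
      qed
      have ys: "\<not> E u s \<and> s \<noteq> u" if "?K y s" for s
      proof -
        have s: "f s = \<beta>" "s \<in> V" "s \<noteq> u" "E y s" using other[OF that] y ab by auto
        then have "s \<notin> X" "s \<notin> Y" using n\<beta>(1) XY[OF _ y(1), of s] E_sym[of y s] by blast+
        then show ?thesis using NXY s by blast
      qed
      have zs: "\<not> E e s \<and> s \<noteq> e" if "?K z s" for s
      proof -
        have s: "f s = \<beta>" "s \<in> V" "s \<noteq> u" "E z s" using other[OF that] z ab by auto
        have "s \<noteq> e" using s(1) e(2) n\<beta>(3) by auto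
        moreover have "s \<notin> X" using XY'[OF _ z(1) \<open>s \<noteq> e\<close>] s(4) E_sym by blast
        moreover have "s \<notin> Y'" using s(1) n\<beta>(2) by auto
        ultimately show ?thesis using Ne' s by blast
      qed
      show "s = t"
        using x
      proof (elim insertE emptyE)
        assume "x = b"
        then show ?thesis
          using st end_of_chain[OF f inV(1) u _ bs] NX(4)[of b] b(1) by blast
      next
        assume "x = y"
        then show ?thesis
          using st end_of_chain[OF f inV(2) u _ ys] NX(4)[of y] y(1) by blast
      next
        assume "x = z"
        then show ?thesis
          using st end_of_chain[OF f inV(3) eV(1) _ zs] E_sym[OF NY'(2)[OF z(1)]] by blast
      qed
    qed
  qed
  \<comment> \<open>Every colour occurs in at least two of the sets \<open>X\<close>,
    \<open>Y\<close> and \<open>insert e Y'\<close>; with \<open>e\<close> restored, the last one is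
    the full star at y'.\<close>
  let ?C = "\<lambda>S i. card {x \<in> S. f x = i}"
  have pos: "1 \<le> ?C S i" if "i \<in> f ` S" "finite S" for S i
    using that card_gt_0_iff[of "{x \<in> S. f x = i}"] by auto
  have "2 \<le> ?C X i + ?C Y i + ?C (insert e Y') i" if i: "i < m" for i
  proof -
    have "i \<in> f ` X \<and> i \<in> f ` Y \<or> i \<in> f ` X \<and> i \<in> f ` insert e Y' \<or> i \<in> f ` Y \<and> i \<in> f ` insert e Y'"
      using noXY[OF i] noXY'[OF i] noYY'[OF i] e by auto
    moreover have "finite (insert e Y')" using finY' by simp
    ultimately show ?thesis
      using pos[OF _ fin(1), of i] pos[OF _ fin(2), of i] pos[of i "insert e Y'"] by linarith
  qed
  then have "(\<Sum>i<m. 2) \<le> (\<Sum>i<m. ?C X i + ?C Y i + ?C (insert e Y') i)"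
    by (intro sum_mono) simp
  moreover have "(\<Sum>i<m. ?C S i) = card S" if "finite S" "S \<subseteq> V - {u}" for S
  proof -
    have "f ` S \<subseteq> {..<m}" using colours_less[OF f] that by auto
    then show ?thesis using sum.group[OF that(1) finite_lessThan, of f m "\<lambda>_. 1 :: nat"] by simp
  qed
  moreover have "X \<subseteq> V - {u}" "Y \<subseteq> V - {u}" "insert e Y' \<subseteq> V - {u}"
    using NX(1,3) NY'(1,3) eV(1,2) by blast+
  ultimately have "2 * m \<le> card X + card Y + card (insert e Y')"
    using fin finY' by (simp add: sum.distrib del: insert_iff insert_subset)
  moreover have "card X + card Y \<le> \<Delta>"
    using degree[OF u] N XYd fin by (simp add: card_Un_disjoint)
  moreover have "card (insert e Y') \<le> w"
    using cle(2) NY'(1,2) eV(1) E_sym[of e] by (intro clique_bound) (auto simp: clique_def)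
  ultimately show False using bound by linarith
qed

end

section \<open>Reed's bound\<close>

context sgraph
begin

text \<open>With t colours on \<open>D\<close>, 2t \<le> |D| + |C| for a maximum clique
  \<open>C\<close> of \<open>D\<close>. Every vertex outside loses |D| neighbours and every clique
  outside can be enlarged by \<open>C\<close>, so \<Delta> - |D|, w - |C| and m - t again satisfy
  the bound.\<close>

lemma colourable_if_join_part_colourable:
  assumes fin: "finite V" and D: "D \<subseteq> V" "D \<noteq> V"
    and join: "\<And>x y. x \<in> D \<Longrightarrow> y \<in> V - D \<Longrightarrow> E x y"
    and degree: "\<And>v. v \<in> V \<Longrightarrow> card {x \<in> V. E v x} \<le> \<Delta>"
    and cliques: "\<And>C. C \<subseteq> V \<Longrightarrow> clique C \<Longrightarrow> card C \<le> w"
    and bound: "\<Delta> + w + 1 \<le> 2 * m"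
    and part: "\<And>\<Delta>' w' m'. \<lbrakk>\<And>v. v \<in> V - D \<Longrightarrow> card {x \<in> V - D. E v x} \<le> \<Delta>';
      \<And>C. C \<subseteq> V - D \<Longrightarrow> clique C \<Longrightarrow> card C \<le> w'; \<Delta>' + w' + 1 \<le> 2 * m'\<rbrakk>
      \<Longrightarrow> colourable (V - D) m'"
  shows "colourable V m"
proof -
  have finD: "finite D" using fin D finite_subset by blast
  obtain C where C: "C \<subseteq> D" "clique C" "\<And>C'. C' \<subseteq> D \<Longrightarrow> clique C' \<Longrightarrow> card C' \<le> card C"
    using exists_max_clique[OF finD] by blast
  obtain t where t: "colourable D t" "2 * t \<le> card D + card C"
    using colourable_half[OF finD, of "card C"] C(3) by blast
  have finC: "finite C" using C finD finite_subset by blast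
  have deg: "card {x \<in> V - D. E v x} + card D \<le> \<Delta>" if v: "v \<in> V - D" for v
  proof -
    have "{x \<in> V. E v x} = {x \<in> V - D. E v x} \<union> D"
      using v join D E_sym by blast
    moreover have "card ({x \<in> V - D. E v x} \<union> D) = card {x \<in> V - D. E v x} + card D"
      using fin finD by (intro card_Un_disjoint) auto
    ultimately show ?thesis using degree[of v] v by simp
  qed
  have cl: "card C' + card C \<le> w" if C': "C' \<subseteq> V - D" "clique C'" for C'
  proof -
    have "E x y" if "x \<in> C" "y \<in> C'" for x y using that C(1) C'(1) join by blast
    then have "clique (C' \<union> C)"
      using C(2) C'(2) E_sym unfolding clique_def by blast
    then have "card (C' \<union> C) \<le> w" using C(1) C'(1) D by (intro cliques) auto
    moreover have "finite C'" using C' fin finite_subset by blast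
    then have "card (C' \<union> C) = card C' + card C"
      using finC C(1) C'(1) by (intro card_Un_disjoint) auto
    ultimately show ?thesis by simp
  qed
  \<comment> \<open>A vertex outside \<open>D\<close> ensures |D| \<le> \<Delta>, so that the
    subtractions on natural numbers are exact.\<close>
  obtain v where "v \<in> V - D" using D by blast
  then have "card D \<le> \<Delta>" using deg[of v] by linarith
  moreover have "card C \<le> w" using cl[of "{}"] by (simp add: clique_def)
  ultimately have "t \<le> m" and le: "\<Delta> - card D + (w - card C) + 1 \<le> 2 * (m - t)"
    using t(2) bound by linarith+
  have "colourable (V - D) (m - t)"
  proof (rule part[OF _ _ le])
    show "card {x \<in> V - D. E v x} \<le> \<Delta> - card D" if "v \<in> V - D" for v
      using deg[OF that] by linarith
    show "card C' \<le> w - card C" if "C' \<subseteq> V - D" "clique C'" for C'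
      using cl[OF that] by linarith
  qed
  then have "colourable (D \<union> (V - D)) (t + (m - t))" by (rule colourable_Un[OF t(1)])
  moreover have "D \<union> (V - D) = V" using D by blast
  ultimately show ?thesis using \<open>t \<le> m\<close> by simp
qed

end

lemma chair_kite_free_subset:
  assumes "chair_kite_free E V" "S \<subseteq> V"
  shows "chair_kite_free E S"
proof -
  interpret chair_kite_free E V by fact
  show ?thesis
  proof unfold_locales
    show "finite S" using assms(2) finite_V finite_subset by blast
    show False if "b \<in> S" "a \<in> S" "c \<in> S" "d \<in> S" "e \<in> S" "E b a" "E b c" "E b d" "E d e"
      "\<not> E a c" "\<not> E a d" "\<not> E a e" "\<not> E c d" "\<not> E c e" "\<not> E b e" "a \<noteq> c" for a b c d e
      using no_chair[of b a c d e] that assms(2) by auto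
    show False if "p \<in> S" "q \<in> S" "r \<in> S" "s \<in> S" "t \<in> S" "E p q" "E p r" "E q r" "E p s" "E q s"
      "E r t" "\<not> E r s" "\<not> E t p" "\<not> E t q" "\<not> E t s" for p q r s t
      using no_kite[of p q r s t] that assms(2) by auto
  qed
qed

text \<open>Free parameters instead of the invariants of the graph serve the induction: proper
  subsets are used with the same values, the part of a join with smaller ones.\<close>

theorem (in sgraph) colourable_chair_kite_free:
  assumes "chair_kite_free E V"
    and "\<And>v. v \<in> V \<Longrightarrow> card {x \<in> V. E v x} \<le> \<Delta>"
    and "\<And>C. C \<subseteq> V \<Longrightarrow> clique C \<Longrightarrow> card C \<le> w"
    and "\<Delta> + w + 1 \<le> 2 * m"
  shows "colourable V m"
proof -
  have "finite V" using assms(1) by (rule chair_kite_free.finite_V)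
  then show ?thesis
    using assms
  proof (induction V arbitrary: \<Delta> w m rule: finite_psubset_induct)
    case (psubset V)
    show ?case
    proof (rule ccontr)
      assume not: "\<not> colourable V m"
      have "minimal_counterexample E V \<Delta> w m"
      proof (intro minimal_counterexample.intro minimal_counterexample_axioms.intro)
        show "chair_kite_free E V" by fact
        show "card {x \<in> V. E v x} \<le> \<Delta>" if "v \<in> V" for v using psubset.prems(2) that .
        show "card C \<le> w" if "C \<subseteq> V" "clique C" for C using psubset.prems(3) that .
        show "\<Delta> + w + 1 \<le> 2 * m" by fact
        show "\<not> colourable V m" by fact
        show "colourable S m" if S: "S \<subset> V" for S
        proof (rule psubset.IH[OF S])
          show "chair_kite_free E S" using chair_kite_free_subset[OF psubset.prems(1)] S by blast
          show "card {x \<in> S. E v x} \<le> \<Delta>" if "v \<in> S" for v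
          proof -
            have "card {x \<in> S. E v x} \<le> card {x \<in> V. E v x}"
              using psubset.hyps S by (intro card_mono) auto
            then show ?thesis using psubset.prems(2)[of v] that S by auto
          qed
          show "card C \<le> w" if "C \<subseteq> S" "clique C" for C
            using psubset.prems(3)[of C] that S by blast
        qed fact
        show "\<exists>x\<in>D. \<exists>y\<in>V - D. \<not> E x y" if D: "D \<subseteq> V" "D \<noteq> {}" "D \<noteq> V" for D
        proof (rule ccontr)
          assume "\<not> ?thesis"
          then have join: "E x y" if "x \<in> D" "y \<in> V - D" for x y using that by blast
          have "V - D \<subset> V" using D by blast
          have "colourable V m"
          proof (rule colourable_if_join_part_colourable[OF psubset.hyps D(1,3) join])
            show "card {x \<in> V. E v x} \<le> \<Delta>" if "v \<in> V" for v using psubset.prems(2) that .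
            show "card C \<le> w" if "C \<subseteq> V" "clique C" for C using psubset.prems(3) that .
            show "\<Delta> + w + 1 \<le> 2 * m" by fact
            show "colourable (V - D) m'"
              if "\<And>v. v \<in> V - D \<Longrightarrow> card {x \<in> V - D. E v x} \<le> \<Delta>'"
                "\<And>C. C \<subseteq> V - D \<Longrightarrow> clique C \<Longrightarrow> card C \<le> w'" "\<Delta>' + w' + 1 \<le> 2 * m'"
              for \<Delta>' w' m'
              using psubset.IH[OF \<open>V - D \<subset> V\<close> _ that]
                chair_kite_free_subset[OF psubset.prems(1)] by blast
          qed
          then show False using not by blast
        qed
      qed
      then show False by (rule minimal_counterexample.impossible)
    qed
  qed
qed

theorem theorem2:
  fixes G :: "'a pair_pre_digraph"
  assumes "pair_graph G"
    and "\<not> contains_induced G Chair"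
    and "\<not> contains_induced G Kite"
  shows "int (chromatic_number G)
    \<le> \<lceil>(real (max_degree G) + real (clique_number G) + 1) / 2\<rceil>"
proof -
  interpret pair_graph G by fact
  interpret C: pair_graph Chair by (rule pair_graph_Chair)
  interpret K: pair_graph Kite by (rule pair_graph_Kite)
  define E where "E u v \<longleftrightarrow> (u, v) \<in> parcs G" for u v
  let ?V = "pverts G"
  interpret sgraph E
  proof
    show "E y x" if "E x y" for x y using that arcs_symmetric by (simp add: E_def)
    show "\<not> E x x" for x using no_loops[of "(x, x)"] by (auto simp: E_def)
  qed
  have wf: "pair_wf_digraph G" "pair_wf_digraph Chair" "pair_wf_digraph Kite"
    by (fact pair_wf_digraph_axioms C.pair_wf_digraph_axioms K.pair_wf_digraph_axioms)+
  have ckf: "chair_kite_free E ?V"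
  proof unfold_locales
    show "finite ?V" by simp
    fix a b c d e assume V: "b \<in> ?V" "a \<in> ?V" "c \<in> ?V" "d \<in> ?V" "e \<in> ?V"
      and E: "E b a" "E b c" "E b d" "E d e" "\<not> E a c" "\<not> E a d" "\<not> E a e" "\<not> E c d"
        "\<not> E c e" "\<not> E b e" "a \<noteq> c"
    define h :: "nat \<Rightarrow> 'a" where "h k = [a, b, c, d, e] ! k" for k
    have ne: "a \<noteq> b" "a \<noteq> d" "a \<noteq> e" "b \<noteq> c" "b \<noteq> d" "b \<noteq> e" "c \<noteq> d" "c \<noteq> e" "d \<noteq> e"
      using E E_sym by auto
    have "contains_induced G Chair"
      unfolding contains_induced_iff[OF wf(1,2)]
      by (rule exI[of _ h]) (use V E ne in \<open>auto simp: Chair_def undirected_def h_def E_def[symmetric] E_commute\<close>)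
    then show False using assms(2) by blast
  next
    fix p q r s t assume V: "p \<in> ?V" "q \<in> ?V" "r \<in> ?V" "s \<in> ?V" "t \<in> ?V"
      and E: "E p q" "E p r" "E q r" "E p s" "E q s" "E r t" "\<not> E r s" "\<not> E t p" "\<not> E t q" "\<not> E t s"
    \<comment> \<open>The order follows \<open>Kite_eq\<close>: 0 and 2 span the common edge of the
      triangles, 1 is the pendant vertex and 4 its neighbour.\<close>
    define h :: "nat \<Rightarrow> 'a" where "h k = [p, t, q, s, r] ! k" for k
    have ne: "p \<noteq> q" "p \<noteq> r" "p \<noteq> s" "p \<noteq> t" "q \<noteq> r" "q \<noteq> s" "q \<noteq> t" "r \<noteq> s" "r \<noteq> t" "s \<noteq> t"
      using E E_sym by auto
    have "contains_induced G Kite"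
      unfolding contains_induced_iff[OF wf(1,3)]
      by (rule exI[of _ h]) (use V E ne in \<open>auto simp: Kite_eq undirected_def h_def E_def[symmetric] E_commute\<close>)
    then show False using assms(3) by blast
  qed
  have deg: "card {x \<in> ?V. E v x} \<le> max_degree G" if "v \<in> ?V" for v
  proof -
    have "out_arcs (with_proj G) v = Pair v ` {x \<in> ?V. E v x}"
      using in_arcsD2 by (auto simp: out_arcs_def E_def)
    then have "out_degree (with_proj G) v = card {x \<in> ?V. E v x}"
      by (simp add: out_degree_def card_image inj_on_def)
    moreover have "out_degree (with_proj G) v \<le> max_degree G"
      unfolding max_degree_def using that by (intro Max_ge) auto
    ultimately show ?thesis by simp
  qed
  have cl: "card C \<le> clique_number G" if "C \<subseteq> ?V" "clique C" for C
  proof -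
    have "finite {S. is_clique G S}"
      by (rule finite_subset[of _ "Pow ?V"]) (auto simp: is_clique_def)
    moreover have "is_clique G C" using that by (auto simp: is_clique_def clique_def E_def)
    ultimately show ?thesis unfolding clique_number_def by (intro Max_ge) auto
  qed
  \<comment> \<open>This is the ceiling of half of \<Delta> + \<omega> + 1 in integer
    division.\<close>
  define m where "m = (max_degree G + clique_number G + 2) div 2"
  have "colourable ?V m"
    by (rule colourable_chair_kite_free[OF ckf deg cl]) (auto simp: m_def)
  then obtain f where "colours ?V m f" by (auto simp: colourable_def)
  then have "proper_colouring G m f"
    using in_arcsD1 in_arcsD2 by (auto simp: proper_colouring_def colours_def E_def)
  then have "chromatic_number G \<le> m"
    unfolding chromatic_number_def by (intro Least_le) blast
  moreover have "int m \<le> \<lceil>(real (max_degree G) + real (clique_number G) + 1) / 2\<rceil>"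
  proof -
    have "2 * real m < real (max_degree G) + real (clique_number G) + 3"
      unfolding m_def by linarith
    then show ?thesis by (simp add: le_ceiling_iff)
  qed
  ultimately show ?thesis by linarith
qed

end
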